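(* Assume that $1<p<+\infty$ and that $u\in\mathcal{L}_s(\mathbb{R}^n)\cap C^{1,1}_{loc}(\mathbb{R}^n)$ is a nonnegative solution of $$-\mathbf{F_s}u(x)+u(x)=u^p(x)\qquad\forall\,x\in\mathbb{R}^n.$$ If $$\limsup_{|x|\to+\infty}u(x)=l<\left(\frac1p\right)^{\frac1{p-1}},$$ then $u$ must be symmetric and monotone decreasing (along the direction $\mathbf{e}$) with respect to some hyperplane $T$ perpendicular to $\mathbf{e}$.
   Context: Let $n\ge 2$, $0<s<1$ and $0<\theta\le\Theta<\infty$. $\mathcal{L}_s(\mathbb{R}^n)$ is the set of functions $u:\mathbb{R}^n\to\mathbb{R}$ with $\int_{\mathbb{R}^n}\frac{|u(x)|}{1+|x|^{n+2s}}\,dx<+\infty$. $C^{1,1}_{loc}$ denotes functions that are $C^1$ with locally Lipschitz gradient. Fix a unit vector $\mathbf{e}\in\mathbb{R}^n$. For $u\in\mathcal{L}_s(\mathbb{R}^n)$ that is $C^{1,1}$ near $x$, $$\mathbf{F_s}u(x):=\inf\left\{P.V.\int_{\mathbb{R}^n}\frac{u(y)-u(x)}{|A^{-1}(y-x)|^{n+2s}}\,dy \;:\; A \text{ a real symmetric } n\times n \text{ matrix},\ \theta I\le A\le\Theta I,\ \mathbf{e} \text{ is an eigenvector of } A\right\}.$$ "Symmetric and monotone decreasing along $\mathbf{e}$ with respect to $T$" means that $u$ is invariant under reflection in $T$ and is monotone decreasing as one moves away from $T$ along lines parallel to $\mathbf{e}$. *)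

theory Defs
  imports "HOL-Analysis.Analysis"
begin

text \<open>Here $\mathbb{R}^n$ is \<^typ>\<open>real ^ 'n\<close>, so that $n$ is \<open>CARD('n)\<close>.\<close>

definition \<L>s :: "real \<Rightarrow> (real ^ 'n \<Rightarrow> real) set" where
  "\<L>s s = {u. u \<in> borel_measurable lebesgue \<and>
     integrable lebesgue (\<lambda>x. \<bar>u x\<bar> / (1 + norm x powr (real CARD('n) + 2 * s)))}"

definition C11_loc :: "(real ^ 'n \<Rightarrow> real) set" where
  "C11_loc = {u. \<exists>grad :: real ^ 'n \<Rightarrow> real ^ 'n.
     (\<forall>x. GDERIV u x :> grad x) \<and>
     (\<forall>x. \<exists>r>0. \<exists>L. L-lipschitz_on (ball x r) grad)}"

definition eigenvector :: "real ^ 'n ^ 'n \<Rightarrow> real ^ 'n \<Rightarrow> bool" where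
  "eigenvector A v \<longleftrightarrow> v \<noteq> 0 \<and> (\<exists>\<mu>. A *v v = \<mu> *\<^sub>R v)"

text \<open>The Loewner inequalities \<open>\<theta> I \<le> A \<le> \<Theta> I\<close> are written out as inequalities between
  quadratic forms.\<close>

definition admissible :: "real \<Rightarrow> real \<Rightarrow> real ^ 'n \<Rightarrow> (real ^ 'n ^ 'n) set" where
  "admissible \<theta> \<Theta> e = {A. transpose A = A \<and>
     (\<forall>\<xi>. \<theta> * (\<xi> \<bullet> \<xi>) \<le> \<xi> \<bullet> (A *v \<xi>) \<and> \<xi> \<bullet> (A *v \<xi>) \<le> \<Theta> * (\<xi> \<bullet> \<xi>)) \<and>
     eigenvector A e}"

definition pv_integral :: "real ^ 'n \<Rightarrow> (real ^ 'n \<Rightarrow> real) \<Rightarrow> real" where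
  "pv_integral x f = Lim (at_right 0) (\<lambda>\<epsilon>. LINT y:- ball x \<epsilon>|lebesgue. f y)"

text \<open>The limit in \<^const>\<open>pv_integral\<close> and the real-valued infimum below are meaningful when \<open>u\<close> is in
  \<^term>\<open>\<L>s s\<close> and is $C^{1,1}$ near \<open>x\<close>, with \<open>0 < s < 1\<close> and \<open>0 < \<theta> \<le> \<Theta>\<close>: the limit then exists
  for every admissible \<open>A\<close>, and the set of its values is nonempty and bounded.\<close>

definition Fs :: "real \<Rightarrow> real \<Rightarrow> real \<Rightarrow> real ^ 'n \<Rightarrow> (real ^ 'n \<Rightarrow> real) \<Rightarrow> real ^ 'n \<Rightarrow> real" where
  "Fs s \<theta> \<Theta> e u x = (INF A\<in>admissible \<theta> \<Theta> e.
     pv_integral x (\<lambda>y. (u y - u x) / norm (matrix_inv A *v (y - x)) powr (real CARD('n) + 2 * s)))"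

definition perp_hyperplane :: "real ^ 'n \<Rightarrow> (real ^ 'n) set \<Rightarrow> bool" where
  "perp_hyperplane e T \<longleftrightarrow> (\<exists>c. T = {x. e \<bullet> x = c})"

definition reflection :: "(real ^ 'n) set \<Rightarrow> real ^ 'n \<Rightarrow> real ^ 'n" where
  "reflection T x = 2 *\<^sub>R closest_point T x - x"

text \<open>Monotonicity is non-strict, as it must be since \<open>u = 0\<close> is a solution.\<close>

definition symmetric_decreasing :: "real ^ 'n \<Rightarrow> (real ^ 'n) set \<Rightarrow> (real ^ 'n \<Rightarrow> real) \<Rightarrow> bool" where
  "symmetric_decreasing e T u \<longleftrightarrow>
     (\<forall>x. u (reflection T x) = u x) \<and>
     (\<forall>x\<in>T. antimono_on {0..} (\<lambda>t. u (x + t *\<^sub>R e)) \<and>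
            antimono_on {0..} (\<lambda>t. u (x - t *\<^sub>R e)))"

end

theory Submission
  imports Defs
begin

text \<open>The proof is a direct moving plane argument for \<open>w l x = u (x\<^sup>*) - u x\<close>, where \<open>x\<^sup>*\<close> is the mirror image
  of \<open>x\<close> in the hyperplane \<open>x \<bullet> e = l\<close>.  Comparing \<open>u\<close> with a small bump near infinity shows that
  \<open>u\<close> vanishes at infinity, because \<open>t - t powr p > 0\<close> for \<open>0 < t < 1\<close>; hence negative infima of \<open>w l\<close> over
  the half space are attained.  At such a minimum \<open>x\<close>, at distance \<open>\<delta>\<close> from the plane, antisymmetry gives
  \<open>Fs u (x\<^sup>*) - Fs u x \<ge> - C w \<delta> powr (-2s)\<close> uniformly in the admissible matrices, since each of them commutes
  with the reflection.  As \<open>t - t powr p\<close> is strictly increasing below the threshold and Lipschitz, this keeps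
  negative minima in a fixed ball and at a fixed distance from the plane.  The plane therefore
  starts at minus infinity and only stops where \<open>w l\<close> vanishes identically; if it never stops, \<open>u\<close> is
  nondecreasing along \<open>e\<close> and vanishes at infinity, so \<open>u = 0\<close>.\<close>

section \<open>Integrability of the kernel and reflections\<close>

text \<open>\<open>Fs\<close> is an infimum, so \<open>w l\<close> solves no linear equation. A
  matrix that almost realises the infimum at the mirror image of \<open>x\<close> also bounds the
  infimum at \<open>x\<close> from above; up to an arbitrarily small error, the difference of the
  two values is therefore at least that of one linear operator acting on \<open>w l\<close>. Which
  matrix this is remains unknown, so every kernel estimate has to be uniform over the admissible
  set. The power of \<delta> is scaling: a ball of volume of order \<delta>^n, weighted by a kernel
  of order \<delta>^(-n-2s). The threshold is the zero of the derivative 1 - p t^(p-1) of the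
  reaction. At a negative minimum the value of \<open>u\<close> drops under reflection, so with
  \<open>u x\<close> below the threshold the equation has the wrong sign; by decay of
  \<open>u\<close> this confines the minimum to a ball. The depth of the minimum cancels in the
  estimate of its distance from the plane, which thus stays bounded below even as the depth tends to
  0. This keeps limits of minima off the plane, in place of a boundary point lemma.\<close>

lemma integrable_dominated_on_balls:
  fixes f :: "'a::euclidean_space \<Rightarrow> real"
  assumes f: "f \<in> borel_measurable borel" "\<And>z. 0 \<le> f z"
    and c: "\<And>k. 0 \<le> c k" and r: "\<And>k. 0 \<le> r k"
    and sm: "summable (\<lambda>k::nat. c k * r k ^ DIM('a))"
    and dom: "\<And>z. f z \<noteq> 0 \<Longrightarrow> \<exists>k. norm z < r k \<and> f z \<le> c k"
  shows "integrable lborel f"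
proof (rule integrableI_nonneg)
  let ?V = "unit_ball_vol (real (DIM('a)))"
  have [measurable]: "ball (0::'a) t \<in> sets borel" for t by simp
  have V: "0 \<le> ?V" by (rule unit_ball_vol_nonneg) simp
  have "(\<integral>\<^sup>+z. ennreal (f z) \<partial>lborel)
      \<le> (\<integral>\<^sup>+z. (\<Sum>k. ennreal (c k) * indicator (ball 0 (r k)) (z::'a)) \<partial>lborel)"
  \<comment> \<open>Where \<open>f z\<close> is nonzero, one term of the series already dominates
    it; the weighted volumes of the balls then bound the integral.\<close>
  proof (rule nn_integral_mono)
    fix z :: 'a
    show "ennreal (f z) \<le> (\<Sum>k. ennreal (c k) * indicator (ball 0 (r k)) z)"
    proof (cases "f z = 0")
      case False
      then obtain k where k: "norm z < r k" "f z \<le> c k" using dom by blast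
      have "ennreal (f z) \<le> ennreal (c k) * indicator (ball 0 (r k)) z"
        using k by (auto intro: ennreal_leI)
      also have "\<dots> = sum (\<lambda>k. ennreal (c k) * indicator (ball 0 (r k)) z) {k}"
        by (simp only: sum.insert finite.emptyI empty_iff not_False_eq_True sum.empty add_0_right)
      also have "\<dots> \<le> (\<Sum>k. ennreal (c k) * indicator (ball 0 (r k)) z)"
        by (rule sum_le_suminf) auto
      finally show ?thesis .
    qed simp
  qed
  also have "\<dots> = (\<Sum>k. \<integral>\<^sup>+z. ennreal (c k) * indicator (ball 0 (r k)) z \<partial>(lborel::'a measure))"
    by (rule nn_integral_suminf) measurable
  also have "\<dots> = (\<Sum>k. ennreal (c k) * ennreal (?V * r k ^ DIM('a)))"
    by (subst nn_integral_cmult_indicator) (simp_all add: emeasure_ball r)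
  also have "\<dots> = (\<Sum>k. ennreal (?V * (c k * r k ^ DIM('a))))"
    by (intro suminf_cong) (simp add: ennreal_mult[symmetric] c r V mult_ac)
  also have "\<dots> < \<infinity>"
    by (subst suminf_ennreal2)
      (auto intro!: mult_nonneg_nonneg c r zero_le_power V summable_mult sm simp: less_top)
  finally show "(\<integral>\<^sup>+z. ennreal (f z) \<partial>lborel) < \<infinity>" .
qed (use f in simp_all)

lemma dyadic_ge_1:
  fixes t :: real
  assumes "1 \<le> t"
  shows "\<exists>k::nat. 2 ^ k \<le> t \<and> t < 2 ^ Suc k"
proof -
  define k where "k = (LEAST k. t < 2 ^ Suc k)"
  obtain m where "t < 2 ^ m" using real_arch_pow[of 2 t] by auto
  then have "t < 2 ^ Suc m" using zero_less_power[of "2::real" m] by (simp add: less_trans)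
  then have k: "t < 2 ^ Suc k" unfolding k_def by (rule LeastI)
  have "2 ^ k \<le> t"
  proof (cases k)
    case (Suc j)
    then show ?thesis using not_less_Least[of j "\<lambda>k. t < 2 ^ Suc k"] k_def by auto
  qed (use assms in simp)
  with k show ?thesis by blast
qed

text \<open>Dyadic shells on both sides of the unit sphere give geometric series. The one at
  infinity converges because the exponent exceeds the dimension, the one at the origin because it
  does so by less than 2, the order of vanishing of the numerator.\<close>

lemma integrable_levy_kernel:
  fixes a :: real
  assumes a: "real (DIM('a::euclidean_space)) < a" "a < real (DIM('a)) + 2"
  shows "integrable lborel (\<lambda>z::'a. min 1 ((norm z)\<^sup>2) / norm z powr a)" (is "integrable lborel ?f")
proof -
  have [measurable]: "ball (0::'a) 1 \<in> sets borel" "- ball (0::'a) 1 \<in> sets borel" by simp_all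
  have a0: "0 < a" using a by linarith
  let ?n = "DIM('a)"
  have far: "integrable lborel (\<lambda>z. ?f z * indicator (- ball 0 1) z)"
  proof (rule integrable_dominated_on_balls[where c = "\<lambda>k. 2 powr (- a * k)" and r = "\<lambda>k. 2 ^ Suc k"])
    have "2 powr (- a * real k) * (2 ^ Suc k) ^ ?n = 2 ^ ?n * (2 powr (?n - a)) ^ k" for k
      by (simp add: powr_realpow[symmetric] powr_powr powr_add[symmetric] powr_mult[symmetric]
          power_mult[symmetric] algebra_simps del: power_Suc)
    moreover have "2 powr (?n - a) < (2::real) powr 0" using a by (intro powr_less_mono) auto
    ultimately show "summable (\<lambda>k. 2 powr (- a * real k) * (2 ^ Suc k) ^ ?n)"
      by (simp only:) (auto intro!: summable_mult summable_geometric)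
  next
    fix z :: 'a assume "?f z * indicator (- ball 0 1) z \<noteq> 0"
    then have z: "1 \<le> norm z" by (auto split: split_indicator_asm)
    obtain k where k: "2 ^ k \<le> norm z" "norm z < 2 ^ Suc k" using dyadic_ge_1[OF z] by blast
    have "?f z \<le> 1 / norm z powr a" by (simp add: divide_right_mono)
    also have "\<dots> \<le> 1 / (2 ^ k) powr a" using k z a0
      by (intro divide_left_mono powr_mono2 mult_pos_pos) auto
    also have "\<dots> = 2 powr (- a * k)"
      by (simp add: powr_realpow[symmetric] powr_powr powr_minus divide_simps mult_ac)
    finally have "?f z * indicator (- ball 0 1) z \<le> 2 powr (- a * k)"
      by (auto split: split_indicator)
    with k show "\<exists>k. norm z < 2 ^ Suc k \<and> ?f z * indicator (- ball 0 1) z \<le> 2 powr (- a * k)" by blast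
  qed (auto intro!: borel_measurable_times borel_measurable_indicator borel_comp)
  have near: "integrable lborel (\<lambda>z. ?f z * indicator (ball 0 1) z)"
  \<comment> \<open>Between the radii 2^(-k-1) and 2^(-k) the quotient is at most 2^(-2k)
    2^(a(k+1)), which is \<open>c k\<close>. The radius is doubled because only
    \<open>norm z \<le> 1 / 2 ^ k\<close> is known, while the balls are open.\<close>
  proof (rule integrable_dominated_on_balls[where c = "\<lambda>k. 2 powr (a - (2 - a) * k)" and r = "\<lambda>k. 2 / 2 ^ k"])
    have "2 powr (a - (2 - a) * real k) * (2 / 2 ^ k) ^ ?n = 2 powr (a + ?n) * (2 powr (a - ?n - 2)) ^ k" for k
    proof -
      have "(2 / 2 ^ k :: real) = 2 powr (1 - real k)"
        by (simp add: powr_diff powr_realpow)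
      then show ?thesis
        by (simp add: powr_realpow[symmetric] powr_powr powr_add[symmetric] algebra_simps)
    qed
    moreover have "2 powr (a - ?n - 2) < (2::real) powr 0" using a by (intro powr_less_mono) auto
    ultimately show "summable (\<lambda>k. 2 powr (a - (2 - a) * real k) * (2 / 2 ^ k) ^ ?n)"
      by (simp only:) (auto intro!: summable_mult summable_geometric)
  next
    fix z :: 'a assume "?f z * indicator (ball 0 1) z \<noteq> 0"
    then have z: "0 < norm z" "norm z < 1" by (auto split: split_indicator_asm)
    obtain k where k: "2 ^ k \<le> 1 / norm z" "1 / norm z < 2 ^ Suc k"
      using dyadic_ge_1[of "1 / norm z"] z by auto
    have up: "norm z \<le> 1 / 2 ^ k" and lo: "1 / 2 ^ Suc k \<le> norm z"
      using k z by (simp_all add: field_simps)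
    have "?f z \<le> (1 / 2 ^ k)\<^sup>2 / norm z powr a"
      using power_mono[OF up, of 2] by (intro divide_right_mono min.coboundedI2) auto
    also have "\<dots> \<le> (1 / 2 ^ k)\<^sup>2 / (1 / 2 ^ Suc k) powr a" using lo z a0
      by (intro divide_left_mono powr_mono2 mult_pos_pos) auto
    also have "\<dots> = 2 powr (a - (2 - a) * k)"
    proof -
      have "(1 / 2 ^ k :: real) = 2 powr (- real k)" "(1 / 2 ^ Suc k :: real) = 2 powr (- real (Suc k))"
        by (simp_all add: powr_realpow[symmetric] powr_minus divide_simps powr_add del: of_nat_Suc power_Suc)
      then show ?thesis
        by (simp only: powr_powr power2_eq_square powr_add[symmetric] powr_diff[symmetric])
          (simp add: algebra_simps)
    qed
    finally have "?f z * indicator (ball 0 1) z \<le> 2 powr (a - (2 - a) * k)"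
      by (auto split: split_indicator)
    moreover have "norm z < 2 / 2 ^ k" using up by (rule order.strict_trans1) (simp add: divide_strict_right_mono)
    ultimately show "\<exists>k. norm z < 2 / 2 ^ k \<and> ?f z * indicator (ball 0 1) z \<le> 2 powr (a - (2 - a) * k)" by blast
  qed (auto intro!: borel_measurable_times borel_measurable_indicator open_Collect_less continuous_intros)
  have "?f = (\<lambda>z. ?f z * indicator (- ball 0 1) z + ?f z * indicator (ball 0 1) z)"
    by (auto split: split_indicator)
  then show ?thesis using Bochner_Integration.integrable_add[OF far near] by simp
qed

section \<open>Reflections and the invariance of Lebesgue measure\<close>

definition mirror :: "real ^ 'n \<Rightarrow> real \<Rightarrow> real ^ 'n \<Rightarrow> real ^ 'n" where
  "mirror e c x = x + (2 * (c - x \<bullet> e)) *\<^sub>R e"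

lemma mirror_inner [simp]: "norm e = 1 \<Longrightarrow> mirror e c x \<bullet> e = 2 * c - x \<bullet> e"
  by (simp add: mirror_def inner_add_left dot_square_norm)

lemma mirror_mirror [simp]: "norm e = 1 \<Longrightarrow> mirror e c (mirror e c x) = x"
  by (simp add: mirror_def inner_add_left dot_square_norm algebra_simps)

lemma dist_mirror: "norm e = 1 \<Longrightarrow> dist (mirror e c x) (mirror e c y) = dist x y"
proof -
  assume e: "norm e = 1"
  have "mirror e c x - mirror e c y = (x - y) - (2 * ((x - y) \<bullet> e)) *\<^sub>R e"
    by (simp add: mirror_def algebra_simps)
  also have "norm (d - (2 * (d \<bullet> e)) *\<^sub>R e) = norm d" for d
  proof -
    have "(d - (2 * (d \<bullet> e)) *\<^sub>R e) \<bullet> (d - (2 * (d \<bullet> e)) *\<^sub>R e) = d \<bullet> d"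
      using e by (simp add: inner_diff_left inner_diff_right norm_eq_1 inner_commute[of e d])
    then show ?thesis by (simp only: norm_eq_sqrt_inner)
  qed
  finally show ?thesis by (simp only: dist_norm)
qed

lemma continuous_mirror [continuous_intros]:
  "continuous_on A f \<Longrightarrow> continuous_on A (\<lambda>x. mirror e c (f x))"
  unfolding mirror_def by (intro continuous_intros)

text \<open>A Vitali cover of an open set by disjoint balls reduces the invariance of Lebesgue measure
  to balls.  The change of variables theorems of the library do not apply, as they
  require a well-ordered index type.\<close>

lemma emeasure_isometric_image_open:
  fixes f :: "'a::euclidean_space \<Rightarrow> 'a"
  assumes iso: "\<And>x y. dist (f x) (f y) = dist x y" and inv: "\<And>x. f (f x) = x"
    and U: "open U" and fU: "open (f ` U)"
  shows "emeasure lborel (f ` U) \<le> emeasure lborel U"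
proof -
  define K where "K = {(x, r). 0 < r \<and> ball x r \<subseteq> U}"
  obtain C where C: "countable C" "C \<subseteq> K"
    and pw: "pairwise (\<lambda>i j. disjnt (ball (fst i) (snd i)) (ball (fst j) (snd j))) C"
    and neg: "negligible (U - (\<Union>i\<in>C. ball (fst i) (snd i)))"
  proof (rule Vitali_covering_theorem_balls[of U K fst snd])
    fix x and d :: real assume "x \<in> U" "0 < d"
    then obtain r where "0 < r" "ball x r \<subseteq> U" using U open_contains_ball by blast
    then show "\<exists>i. i \<in> K \<and> x \<in> ball (fst i) (snd i) \<and> snd i < d" using \<open>0 < d\<close>
      by (intro exI[of _ "(x, min r (d / 2))"]) (auto simp: K_def)
  qed blast
  let ?B = "\<lambda>i. ball (fst i) (snd i)" and ?fB = "\<lambda>i. ball (f (fst i)) (snd i)"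
  let ?N = "f ` (U - (\<Union>i\<in>C. ?B i))"
  \<comment> \<open>An isometry is Lipschitz with constant 1, so the part of \<open>U\<close> missed
    by the balls stays negligible after mapping.\<close>
  have "negligible ?N"
  proof (rule negligible_locally_Lipschitz_image[OF _ neg])
    show "\<exists>T B. open T \<and> x \<in> T \<and> (\<forall>y\<in>(U - (\<Union>i\<in>C. ?B i)) \<inter> T. norm (f y - f x) \<le> B * norm (y - x))" for x
      by (intro exI[of _ UNIV] exI[of _ 1]) (simp add: dist_norm[symmetric] iso)
  qed simp
  then obtain N where N: "N \<in> null_sets lborel" "?N \<subseteq> N"
    by (auto simp: negligible_iff_null_sets null_sets_completion_iff2)
  have "f ` U \<subseteq> (\<Union>i\<in>C. ?fB i) \<union> N"
    using N(2) by (force simp: iso)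
  then have "emeasure lborel (f ` U) \<le> emeasure lborel ((\<Union>i\<in>C. ?fB i) \<union> N)"
    using N(1) by (intro emeasure_mono sets.Un) (auto dest: null_setsD2 intro: borel_open open_UN)
  also have "\<dots> = emeasure lborel (\<Union>i\<in>C. ?fB i)"
    using N(1) by (intro emeasure_Un_null_set) (auto intro!: borel_open open_UN)
  also have "\<dots> = (\<integral>\<^sup>+i. emeasure lborel (?fB i) \<partial>count_space C)"
  proof (rule emeasure_UN_countable)
    have "f -` ?B i = ?fB i" for i
      by (auto simp: iso) (metis iso inv)+
    moreover have "disjoint_family_on (\<lambda>i. f -` ?B i) C"
      using pw by (fastforce simp: disjoint_family_on_def pairwise_def disjnt_def)
    ultimately show "disjoint_family_on ?fB C" by simp
  qed (use C in auto)
  also have "\<dots> = (\<integral>\<^sup>+i. emeasure lborel (?B i) \<partial>count_space C)"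
    by (rule nn_integral_cong) (use C in \<open>auto simp: K_def emeasure_ball\<close>)
  also have "\<dots> = emeasure lborel (\<Union>i\<in>C. ?B i)"
    by (rule emeasure_UN_countable[symmetric])
      (use C pw in \<open>auto simp: disjoint_family_on_def pairwise_def disjnt_def\<close>)
  also have "\<dots> \<le> emeasure lborel U"
    using U C by (intro emeasure_mono) (fastforce simp: K_def)+
  finally show ?thesis .
qed

text \<open>Volumes of boxes determine \<open>lborel\<close>. The one-sided estimate for open sets
  is used twice, for a box and for its image, because \<open>f\<close> undoes itself.\<close>

lemma lborel_distr_isometric_involution:
  fixes f :: "'a::euclidean_space \<Rightarrow> 'a"
  assumes iso: "\<And>x y. dist (f x) (f y) = dist x y" and inv: "\<And>x. f (f x) = x"
  shows "distr lborel borel f = lborel"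
proof (rule lborel_eqI[symmetric])
  fix l u :: 'a
  have cont: "continuous_on UNIV f"
    unfolding continuous_on_iff by (metis iso)
  have vim: "f ` S = f -` S" for S using inv by (auto simp: image_iff) (metis inv)
  have op: "open S \<Longrightarrow> open (f ` S)" for S
    unfolding vim using cont by (simp add: open_vimage)
  have "emeasure lborel (f ` box l u) = emeasure lborel (box l u)"
  proof (rule antisym)
    show "emeasure lborel (f ` box l u) \<le> emeasure lborel (box l u)"
      by (intro emeasure_isometric_image_open iso inv op) auto
    have "emeasure lborel (f ` f ` box l u) \<le> emeasure lborel (f ` box l u)"
      by (intro emeasure_isometric_image_open iso inv op) auto
    then show "emeasure lborel (box l u) \<le> emeasure lborel (f ` box l u)"
      by (simp add: image_image inv)
  qed
  moreover have "emeasure (distr lborel borel f) (box l u) = emeasure lborel (f ` box l u)"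
    using borel_measurable_continuous_onI[OF cont] by (subst emeasure_distr) (simp_all add: vim)
  moreover assume "\<And>b. b \<in> Basis \<Longrightarrow> l \<bullet> b \<le> u \<bullet> b"
  ultimately show "emeasure (distr lborel borel f) (box l u) = (\<Prod>b\<in>Basis. (u - l) \<bullet> b)"
    by (simp add: emeasure_lborel_box)
qed simp

lemma integral_isometric_involution:
  fixes g :: "'a::euclidean_space \<Rightarrow> real"
  assumes iso: "\<And>x y. dist (f x) (f y) = dist x y" and inv: "\<And>x. f (f x) = x"
    and g: "g \<in> borel_measurable borel"
  shows "(LINT z|lborel. g (f z)) = (LINT z|lborel. g z)"
    and "integrable lborel g \<Longrightarrow> integrable lborel (\<lambda>z. g (f z))"
proof -
  have "continuous_on UNIV f"
    unfolding continuous_on_iff by (metis iso)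
  then have m: "f \<in> measurable lborel borel"
    by (simp add: borel_measurable_continuous_onI)
  show "(LINT z|lborel. g (f z)) = (LINT z|lborel. g z)"
    using integral_distr[OF m g] by (simp add: lborel_distr_isometric_involution iso inv)
  show "integrable lborel (\<lambda>z. g (f z))" if "integrable lborel g"
    using integrable_distr_eq[OF m g] that by (simp add: lborel_distr_isometric_involution iso inv)
qed

section \<open>Admissible matrices and their kernels\<close>

text \<open>At the origin division by zero gives the value 0. Upper bounds therefore hold there too,
  whereas lower bounds and comparisons from below ask for \<open>z \<noteq> 0\<close>.\<close>

definition levy_kernel :: "real ^ 'n ^ 'n \<Rightarrow> real \<Rightarrow> real ^ 'n \<Rightarrow> real" where
  "levy_kernel A a z = 1 / norm (matrix_inv A *v z) powr a"

lemma admissible_inverse: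
  fixes A :: "real ^ 'n ^ 'n"
  assumes A: "A \<in> admissible \<theta> \<Theta> e" and \<theta>: "0 < \<theta>"
  shows "A *v (matrix_inv A *v z) = z" "matrix_inv A *v (A *v z) = z"
proof -
  have "x = 0" if "A *v x = 0" for x
  proof -
    have "\<theta> * (x \<bullet> x) \<le> x \<bullet> (A *v x)" using A by (simp add: admissible_def)
    then have "x \<bullet> x \<le> 0" using that \<theta> by (simp add: mult_le_0_iff)
    then show ?thesis using inner_gt_zero_iff[of x] by linarith
  qed
  then have "invertible A"
    by (simp add: invertible_left_inverse matrix_left_invertible_ker)
  then have "A ** matrix_inv A = mat 1 \<and> matrix_inv A ** A = mat 1"
    unfolding invertible_def matrix_inv_def by (rule someI_ex)
  then show "A *v (matrix_inv A *v z) = z" "matrix_inv A *v (A *v z) = z"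
    by (simp_all add: matrix_vector_mul_assoc)
qed

lemma admissible_inverse_norm:
  fixes A :: "real ^ 'n ^ 'n"
  assumes A: "A \<in> admissible \<theta> \<Theta> e" and \<theta>: "0 < \<theta>" "\<theta> \<le> \<Theta>"
  shows "norm (matrix_inv A *v z) \<le> norm z / \<theta>" "norm z / \<Theta> \<le> norm (matrix_inv A *v z)"
proof -
  define y where "y = matrix_inv A *v z"
  have z: "z = A *v y" using admissible_inverse[OF A \<theta>(1)] by (simp add: y_def)
  have q: "\<theta> * (\<xi> \<bullet> \<xi>) \<le> \<xi> \<bullet> (A *v \<xi>)" "\<xi> \<bullet> (A *v \<xi>) \<le> \<Theta> * (\<xi> \<bullet> \<xi>)" for \<xi>
    using A by (auto simp: admissible_def)
  have sym: "x \<bullet> (A *v w) = (A *v x) \<bullet> w" for x w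
    using A dot_lmul_matrix[of x A w] transpose_matrix_vector[of A x] by (simp add: admissible_def)
  have "\<theta> * (norm y * norm y) \<le> norm y * norm z"
    using q(1)[of y] norm_cauchy_schwarz[of y z] z by (simp add: dot_square_norm power2_eq_square)
  then have "\<theta> * norm y \<le> norm z"
    by (cases "y = 0") (simp_all add: z mult.left_commute[of \<theta>])
  then show "norm (matrix_inv A *v z) \<le> norm z / \<theta>" using \<theta> by (simp add: y_def field_simps)
  have \<Theta>: "0 < \<Theta>" using \<theta> by simp
  \<comment> \<open>Testing the nonnegative form of \<open>A\<close> at this vector gives |Ay|^2
    \<le> \<Theta> (y, Ay) without a spectral decomposition. The factor 1/\<Theta> is the best one
    once (z, Az) is replaced by \<Theta> |z|^2.\<close>
  let ?v = "y - (1 / \<Theta>) *\<^sub>R z"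
  have "0 \<le> ?v \<bullet> (A *v ?v)"
    using q(1)[of ?v] \<theta>(1) by (meson inner_ge_zero less_imp_le mult_nonneg_nonneg order_trans)
  also have "?v \<bullet> (A *v ?v) = y \<bullet> z - 2 * (z \<bullet> z) / \<Theta> + (z \<bullet> (A *v z)) / \<Theta>\<^sup>2"
  proof -
    have "A *v ?v = z - (1 / \<Theta>) *\<^sub>R (A *v z)"
      by (simp only: matrix_vector_mult_diff_distrib matrix_vector_mult_scaleR z[symmetric])
    moreover have "y \<bullet> (A *v z) = z \<bullet> z"
      by (simp only: sym z[symmetric])
    ultimately show ?thesis
      by (simp only: inner_diff_left inner_diff_right inner_scaleR_left inner_scaleR_right)
        (simp add: power2_eq_square add_divide_distrib diff_divide_distrib)
  qed
  also have "(z \<bullet> (A *v z)) / \<Theta>\<^sup>2 \<le> (\<Theta> * (z \<bullet> z)) / \<Theta>\<^sup>2"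
    by (intro divide_right_mono q) simp
  finally have "(z \<bullet> z) / \<Theta> \<le> y \<bullet> z" using \<Theta> by (simp add: power2_eq_square)
  then have "norm z * norm z \<le> norm z * (\<Theta> * norm y)"
    using norm_cauchy_schwarz[of y z] \<Theta> by (simp add: dot_square_norm power2_eq_square field_simps)
      (smt (verit) mult.commute mult_left_mono)
  then have "norm z \<le> \<Theta> * norm y" using \<Theta> by (cases "z = 0") simp_all
  then show "norm z / \<Theta> \<le> norm (matrix_inv A *v z)" using \<Theta> by (simp add: y_def field_simps)
qed

text \<open>Since \<open>e\<close> is an eigenvector of the symmetric matrix \<open>A\<close>, the components of \<open>z\<close> along \<open>e\<close> and
  orthogonal to \<open>e\<close> contribute separately to the norm of the inverse image.\<close>

lemma admissible_inverse_mirror: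
  fixes A :: "real ^ 'n ^ 'n"
  assumes A: "A \<in> admissible \<theta> \<Theta> e" and \<theta>: "0 < \<theta>" and e: "norm e = 1"
  obtains \<mu> where "\<theta> \<le> \<mu>" "\<mu> \<le> \<Theta>"
    "\<And>c z. (norm (matrix_inv A *v mirror e c z))\<^sup>2 = (norm (matrix_inv A *v z))\<^sup>2 + 4 * c * (c - z \<bullet> e) / \<mu>\<^sup>2"
proof -
  obtain \<mu> where \<mu>: "A *v e = \<mu> *\<^sub>R e" using A by (auto simp: admissible_def eigenvector_def)
  have ee: "e \<bullet> e = 1" using e by (simp add: dot_square_norm)
  have "\<theta> * (e \<bullet> e) \<le> e \<bullet> (A *v e) \<and> e \<bullet> (A *v e) \<le> \<Theta> * (e \<bullet> e)"
    using A by (simp add: admissible_def)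
  then have b: "\<theta> \<le> \<mu>" "\<mu> \<le> \<Theta>" by (simp_all add: \<mu> ee)
  then have \<mu>0: "0 < \<mu>" using \<theta> by simp
  have sym: "x \<bullet> (A *v w) = (A *v x) \<bullet> w" for x w
    using A dot_lmul_matrix[of x A w] transpose_matrix_vector[of A x] by (simp add: admissible_def)
  have Be: "matrix_inv A *v e = (1 / \<mu>) *\<^sub>R e"
    using admissible_inverse(2)[OF A \<theta>, of "(1 / \<mu>) *\<^sub>R e"] \<mu>0 by (simp add: matrix_vector_mult_scaleR \<mu>)
  have ip: "(matrix_inv A *v z) \<bullet> e = (z \<bullet> e) / \<mu>" for z
    using sym[of "matrix_inv A *v z" e] admissible_inverse(1)[OF A \<theta>, of z] \<mu>0 by (simp add: \<mu> field_simps)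
  show ?thesis
  proof (rule that[OF b])
    fix c z
    define k where "k = 2 * (c - z \<bullet> e)"
    have "matrix_inv A *v mirror e c z = matrix_inv A *v z + (k / \<mu>) *\<^sub>R e"
      by (simp add: mirror_def matrix_vector_right_distrib matrix_vector_mult_scaleR Be k_def)
    then have "(norm (matrix_inv A *v mirror e c z))\<^sup>2
        = (matrix_inv A *v z + (k / \<mu>) *\<^sub>R e) \<bullet> (matrix_inv A *v z + (k / \<mu>) *\<^sub>R e)"
      by (simp only: power2_norm_eq_inner)
    also have "\<dots> = (norm (matrix_inv A *v z))\<^sup>2 + 2 * (k / \<mu>) * ((z \<bullet> e) / \<mu>) + (k / \<mu>)\<^sup>2"
      by (simp only: power2_norm_eq_inner inner_add_left inner_add_right inner_scaleR_left
          inner_scaleR_right ip ee inner_commute[of e "matrix_inv A *v z"])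
        (simp add: power2_eq_square add_divide_distrib algebra_simps)
    also have "\<dots> = (norm (matrix_inv A *v z))\<^sup>2 + 4 * c * (c - z \<bullet> e) / \<mu>\<^sup>2"
      using \<mu>0 by (simp add: k_def power2_eq_square field_simps)
    finally show "(norm (matrix_inv A *v mirror e c z))\<^sup>2 = \<dots>" .
  qed
qed

lemma levy_kernel_nonneg [simp]: "0 \<le> levy_kernel A a z"
  by (simp add: levy_kernel_def)

lemma levy_kernel_minus [simp]: "levy_kernel A a (- z) = levy_kernel A a z"
  by (simp add: levy_kernel_def linear_neg[OF matrix_vector_mul_linear])

lemma levy_kernel_measurable [measurable]: "levy_kernel A a \<in> borel_measurable borel"
proof -
  have [measurable]: "(\<lambda>z. matrix_inv A *v z) \<in> borel_measurable borel"
    by (intro borel_measurable_continuous_onI linear_continuous_on linear_conv_bounded_linear[THEN iffD1] matrix_vector_mul_linear)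
  show ?thesis unfolding levy_kernel_def by measurable
qed

lemma levy_kernel_le:
  assumes "A \<in> admissible \<theta> \<Theta> e" "0 < \<theta>" "\<theta> \<le> \<Theta>" "0 < a"
  shows "levy_kernel A a z \<le> \<Theta> powr a / norm z powr a"
proof (cases "z = 0")
  case False
  have "(norm z / \<Theta>) powr a \<le> norm (matrix_inv A *v z) powr a"
    using assms by (intro powr_mono2 admissible_inverse_norm) auto
  moreover have "0 < (norm z / \<Theta>) powr a" using False assms by simp
  ultimately have "levy_kernel A a z \<le> 1 / (norm z / \<Theta>) powr a"
    unfolding levy_kernel_def by (intro divide_left_mono mult_pos_pos) auto
  then show ?thesis using assms by (simp add: powr_divide)
qed (use assms in \<open>simp add: levy_kernel_def\<close>)

lemma inverse_image_pos:
  assumes "A \<in> admissible \<theta> \<Theta> e" "0 < \<theta>" "z \<noteq> 0"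
  shows "0 < norm (matrix_inv A *v z)"
  using admissible_inverse(1)[OF assms(1,2), of z] assms(3) by auto

lemma levy_kernel_ge:
  assumes "A \<in> admissible \<theta> \<Theta> e" "0 < \<theta>" "\<theta> \<le> \<Theta>" "0 < a" "z \<noteq> 0" "norm z \<le> r"
  shows "(\<theta> / r) powr a \<le> levy_kernel A a z"
proof -
  have "norm (matrix_inv A *v z) \<le> r / \<theta>"
    using admissible_inverse_norm(1)[OF assms(1-3), of z] assms by (meson divide_right_mono less_imp_le order_trans)
  then have "norm (matrix_inv A *v z) powr a \<le> (r / \<theta>) powr a"
    using assms by (intro powr_mono2) auto
  moreover have "0 < r" using assms by (smt (verit) zero_less_norm_iff)
  ultimately have "1 / (r / \<theta>) powr a \<le> levy_kernel A a z"
    unfolding levy_kernel_def using inverse_image_pos[OF assms(1,2,5)] assms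
    by (intro divide_left_mono mult_pos_pos) auto
  then show ?thesis using assms \<open>0 < r\<close> by (simp add: powr_divide)
qed

text \<open>For \<open>c = 0\<close> the extra term of \<open>admissible_inverse_mirror\<close>
  vanishes: the linear reflection commutes with \<open>A\<close> because \<open>e\<close> is an
  eigenvector.\<close>

lemma levy_kernel_mirror_0:
  assumes "A \<in> admissible \<theta> \<Theta> e" "0 < \<theta>" "norm e = 1"
  shows "levy_kernel A a (mirror e 0 z) = levy_kernel A a z"
proof -
  obtain \<mu> where "(norm (matrix_inv A *v mirror e 0 z))\<^sup>2 = (norm (matrix_inv A *v z))\<^sup>2 + 4 * 0 * (0 - z \<bullet> e) / \<mu>\<^sup>2"
    using admissible_inverse_mirror[OF assms] by metis
  then show ?thesis by (simp add: levy_kernel_def)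
qed

text \<open>Reflection in a plane beyond both \<open>z\<close> and the origin adds the nonnegative
  amount 4c(c - z \<bullet> e)/\<mu>^2 to the squared norm of the inverse image, and the kernel
  decreases with that norm.\<close>

lemma levy_kernel_mirror_le:
  assumes "A \<in> admissible \<theta> \<Theta> e" "0 < \<theta>" "norm e = 1" "0 < a" "0 \<le> c" "z \<bullet> e \<le> c" "z \<noteq> 0"
  shows "levy_kernel A a (mirror e c z) \<le> levy_kernel A a z"
proof -
  obtain \<mu> where "(norm (matrix_inv A *v mirror e c z))\<^sup>2 = (norm (matrix_inv A *v z))\<^sup>2 + 4 * c * (c - z \<bullet> e) / \<mu>\<^sup>2"
    using admissible_inverse_mirror[OF assms(1-3)] by metis
  moreover have "0 \<le> 4 * c * (c - z \<bullet> e) / \<mu>\<^sup>2" using assms by simp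
  ultimately have "(norm (matrix_inv A *v z))\<^sup>2 \<le> (norm (matrix_inv A *v mirror e c z))\<^sup>2" by linarith
  then have le: "norm (matrix_inv A *v z) \<le> norm (matrix_inv A *v mirror e c z)"
    by (rule power2_le_imp_le) simp
  with inverse_image_pos[OF assms(1,2,7)] show ?thesis unfolding levy_kernel_def
    using assms by (intro divide_left_mono powr_mono2 mult_pos_pos) auto
qed

text \<open>After factoring out q^(-b) the gap is a product of two factors, both decreasing in
  \<open>q\<close>; it also grows with the increment. It is applied to squared norms with
  \<open>b = a / 2\<close>, to find the worst case over all matrices.\<close>

lemma powr_gap_mono:
  fixes q Q d D b :: real
  assumes "0 < q" "q \<le> Q" "0 \<le> d" "d \<le> D" "0 \<le> b"
  shows "Q powr (- b) - (Q + d) powr (- b) \<le> q powr (- b) - (q + D) powr (- b)"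
proof -
  have eq: "x powr (- b) - (x + d) powr (- b) = x powr (- b) * (1 - (x / (x + d)) powr b)" if "0 < x" for x
    using that assms by (simp add: powr_divide powr_minus field_simps)
  have "q / (q + d) \<le> Q / (Q + d)" using mult_right_mono[of q Q d] assms by (simp add: divide_simps algebra_simps)
  then have 1: "(q / (q + d)) powr b \<le> (Q / (Q + d)) powr b" using assms by (intro powr_mono2) auto
  have 2: "(Q / (Q + d)) powr b \<le> 1" using assms by (intro powr_le1) auto
  have "Q powr (- b) \<le> q powr (- b)" using assms by (intro powr_mono2') auto
  then have "Q powr (- b) - (Q + d) powr (- b) \<le> q powr (- b) - (q + d) powr (- b)"
    using 1 2 assms by (simp only: eq) (intro mult_mono, auto)
  moreover have "(q + D) powr (- b) \<le> (q + d) powr (- b)" using assms by (intro powr_mono2') auto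
  ultimately show ?thesis by linarith
qed

text \<open>The quantitative form of \<open>levy_kernel_mirror_le\<close>. Its point is that
  \<kappa> depends neither on the matrix nor on \<open>z\<close>.\<close>

lemma levy_kernel_gap:
  assumes \<theta>: "0 < \<theta>" "\<theta> \<le> \<Theta>" and e: "norm e = 1" and "0 < a" "0 < c" "0 < d" "0 < r"
  obtains \<kappa> where "0 < \<kappa>"
    "\<And>A z. A \<in> admissible \<theta> \<Theta> e \<Longrightarrow> z \<noteq> 0 \<Longrightarrow> norm z \<le> r \<Longrightarrow> z \<bullet> e \<le> c - d
      \<Longrightarrow> levy_kernel A a (mirror e c z) + \<kappa> \<le> levy_kernel A a z"
proof
  \<comment> \<open>The worst case: \<open>Q\<close> is the largest squared norm of the inverse
    image for \<open>norm z \<le> r\<close>, and \<open>D\<close> the smallest increment under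
    reflection.\<close>
  define Q where "Q = (r / \<theta>)\<^sup>2"
  define D where "D = 4 * c * d / \<Theta>\<^sup>2"
  have Q: "0 < Q" and D: "0 < D" using assms by (auto simp: Q_def D_def)
  then show "0 < Q powr (- (a / 2)) - (Q + D) powr (- (a / 2))"
    using \<open>0 < a\<close> by (simp add: powr_less_mono2_neg)
  fix A z assume A: "A \<in> admissible \<theta> \<Theta> e" and z: "z \<noteq> 0" "norm z \<le> r" "z \<bullet> e \<le> c - d"
  obtain \<mu> where \<mu>: "\<theta> \<le> \<mu>" "\<mu> \<le> \<Theta>"
    and eq: "(norm (matrix_inv A *v mirror e c z))\<^sup>2 = (norm (matrix_inv A *v z))\<^sup>2 + 4 * c * (c - z \<bullet> e) / \<mu>\<^sup>2"
    using admissible_inverse_mirror[OF A \<theta>(1) e] by metis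
  define q where "q = (norm (matrix_inv A *v z))\<^sup>2"
  define D' where "D' = 4 * c * (c - z \<bullet> e) / \<mu>\<^sup>2"
  have pos: "0 < norm (matrix_inv A *v z)" using inverse_image_pos[OF A \<theta>(1) z(1)] .
  then have q: "0 < q" by (simp add: q_def)
  have "norm (matrix_inv A *v z) \<le> r / \<theta>"
    using admissible_inverse_norm(1)[OF A \<theta>, of z] z(2) \<theta> by (meson divide_right_mono less_imp_le order_trans)
  then have qQ: "q \<le> Q" unfolding q_def Q_def by (intro power_mono) auto
  have DD: "D \<le> D'" unfolding D_def D'_def using \<mu> \<theta> z assms
    by (intro frac_le mult_left_mono power_mono mult_nonneg_nonneg) auto
  have pw: "1 / t powr a = (t\<^sup>2) powr (- (a / 2))" if "0 \<le> t" for t :: real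
  proof (cases "t = 0")
    case False
    then have "t\<^sup>2 = t powr 2" using that by simp
    then show ?thesis by (simp only: powr_powr) (simp add: powr_minus_divide)
  qed simp
  show "levy_kernel A a (mirror e c z) + (Q powr (- (a / 2)) - (Q + D) powr (- (a / 2))) \<le> levy_kernel A a z"
    using powr_gap_mono[OF q qQ less_imp_le[OF D] DD, of "a / 2"] \<open>0 < a\<close>
    by (simp add: levy_kernel_def pw eq q_def D'_def)
qed

lemma admissible_nonempty:
  assumes "0 < \<theta>" "\<theta> \<le> \<Theta>" "norm e = 1"
  shows "mat \<theta> \<in> admissible \<theta> \<Theta> e"
proof -
  have m: "mat \<theta> *v x = \<theta> *\<^sub>R x" for x :: "real ^ 'n"
    by (simp add: vec_eq_iff matrix_vector_mult_def mat_def if_distrib[where f="\<lambda>y. y * _"] cong: if_cong)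
  have "e \<noteq> 0" using assms(3) by auto
  moreover have "transpose (mat \<theta>) = (mat \<theta> :: real ^ 'n ^ 'n)" by (rule transpose_mat)
  ultimately show ?thesis using assms by (auto simp: admissible_def eigenvector_def m intro!: mult_right_mono)
qed

section \<open>The principal value\<close>

text \<open>The operators act at the origin; a point \<open>x\<close> enters through
  \<open>V z = u (x + z)\<close>. Subtraction and reflection are carried out on the truncated form,
  whose integrals converge for bounded \<open>V\<close>, and only then is the limit taken.\<close>

definition truncated_levy :: "real ^ 'n ^ 'n \<Rightarrow> real \<Rightarrow> (real ^ 'n \<Rightarrow> real) \<Rightarrow> real \<Rightarrow> real" where
  "truncated_levy A a V \<epsilon> = (LINT z|lborel. indicator (- ball 0 \<epsilon>) z * ((V z - V 0) * levy_kernel A a z))"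

definition levy_operator :: "real ^ 'n ^ 'n \<Rightarrow> real \<Rightarrow> (real ^ 'n \<Rightarrow> real) \<Rightarrow> real" where
  "levy_operator A a V = (LINT z|lborel. (V z + V (- z) - 2 * V 0) * levy_kernel A a z) / 2"

text \<open>The second bound is free of \<open>A\<close>: it is what makes the family of values
  under the infimum bounded below.\<close>

lemma integrable_const_levy_kernel:
  fixes A :: "real ^ 'n ^ 'n"
  assumes A: "A \<in> admissible \<theta> \<Theta> e" "0 < \<theta>" "\<theta> \<le> \<Theta>"
    and a: "real CARD('n) < a" "a < real CARD('n) + 2"
    and g: "g \<in> borel_measurable borel" and dom: "\<And>z. \<bar>g z\<bar> \<le> C * min 1 ((norm z)\<^sup>2)"
  shows "integrable lborel (\<lambda>z. g z * levy_kernel A a z)"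
    and "\<bar>LINT z|lborel. g z * levy_kernel A a z\<bar>
      \<le> C * \<Theta> powr a * (LINT z|lborel. min 1 ((norm z)\<^sup>2) / norm (z :: real ^ 'n) powr a)"
proof -
  have a0: "0 < a" using a by (smt (verit) of_nat_0_le_iff)
  let ?m = "\<lambda>z :: real ^ 'n. min 1 ((norm z)\<^sup>2) / norm z powr a"
  have int: "integrable lborel ?m"
    using a by (intro integrable_levy_kernel) auto
  then have int': "integrable lborel (\<lambda>z. C * \<Theta> powr a * ?m z)" by (rule integrable_mult_right)
  have bd: "norm (g z * levy_kernel A a z) \<le> C * \<Theta> powr a * ?m z" for z
  proof -
    have "norm (g z * levy_kernel A a z) = \<bar>g z\<bar> * levy_kernel A a z" by (simp add: abs_mult)
    also have "\<dots> \<le> (C * min 1 ((norm z)\<^sup>2)) * (\<Theta> powr a / norm z powr a)"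
      by (intro mult_mono levy_kernel_le[OF A a0] dom order_trans[OF abs_ge_zero dom]) simp
    finally have "norm (g z * levy_kernel A a z) \<le> (C * min 1 ((norm z)\<^sup>2)) * (\<Theta> powr a / norm z powr a)" .
    then show ?thesis by (simp add: mult_ac)
  qed
  have meas: "(\<lambda>z. g z * levy_kernel A a z) \<in> borel_measurable lborel"
    using g by (simp add: borel_measurable_times)
  show I: "integrable lborel (\<lambda>z. g z * levy_kernel A a z)"
    by (rule Bochner_Integration.integrable_bound[OF int' meas])
      (rule AE_I2, rule order_trans[OF bd], simp only: real_norm_def abs_ge_self)
  have "norm (LINT z|lborel. g z * levy_kernel A a z) \<le> (LINT z|lborel. C * \<Theta> powr a * ?m z)"
    by (rule Bochner_Integration.integral_norm_bound_integral[OF I int']) (use bd in auto)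
  then show "\<bar>LINT z|lborel. g z * levy_kernel A a z\<bar> \<le> C * \<Theta> powr a * (LINT z|lborel. ?m z)"
    by (simp only: integral_mult_right_zero real_norm_def)
qed

lemma integrable_truncated_levy:
  fixes A :: "real ^ 'n ^ 'n"
  assumes A: "A \<in> admissible \<theta> \<Theta> e" "0 < \<theta>" "\<theta> \<le> \<Theta>"
    and a: "real CARD('n) < a" "a < real CARD('n) + 2"
    and g: "g \<in> borel_measurable borel" and bd: "\<And>z. \<bar>g z\<bar> \<le> M" and \<epsilon>: "0 < \<epsilon>"
  shows "integrable lborel (\<lambda>z. indicator (- ball 0 \<epsilon>) z * (g z * levy_kernel A a z))"
proof -
  have M: "0 \<le> M" using bd[of 0] by linarith
  have [measurable]: "- ball (0 :: real ^ 'n) \<epsilon> \<in> sets borel" by (intro borel_comp) simp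
  have "integrable lborel (\<lambda>z. (indicator (- ball 0 \<epsilon>) z * g z) * levy_kernel A a z)"
  proof (rule integrable_const_levy_kernel(1)[OF A a])
    show "(\<lambda>z. indicator (- ball 0 \<epsilon>) z * g z) \<in> borel_measurable borel"
      using g by measurable
    fix z :: "real ^ 'n"
    \<comment> \<open>Off the ball of radius \<epsilon> the constant 1 is itself at most
      \<open>max 1 (1 / \<epsilon>\<^sup>2)\<close> times the quadratic weight, so boundedness of
      \<open>g\<close> suffices.\<close>
    show "\<bar>indicator (- ball 0 \<epsilon>) z * g z\<bar> \<le> M * max 1 (1 / \<epsilon>\<^sup>2) * min 1 ((norm z)\<^sup>2)"
    proof (cases "z \<in> ball 0 \<epsilon>")
      case False
      then have "\<epsilon>\<^sup>2 \<le> (norm z)\<^sup>2" using \<epsilon> by (intro power_mono) auto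
      then have "1 \<le> (1 / \<epsilon>\<^sup>2) * (norm z)\<^sup>2" using \<epsilon> by (simp add: field_simps)
      also have "\<dots> \<le> max 1 (1 / \<epsilon>\<^sup>2) * (norm z)\<^sup>2" by (intro mult_right_mono) auto
      finally have "1 \<le> max 1 (1 / \<epsilon>\<^sup>2) * min 1 ((norm z)\<^sup>2)"
        by (cases "1 \<le> (norm z)\<^sup>2") (simp_all only: min_absorb1 min_absorb2 linear not_le less_imp_le mult_1_right max.cobounded1)
      then have "M * 1 \<le> M * (max 1 (1 / \<epsilon>\<^sup>2) * min 1 ((norm z)\<^sup>2))"
        using M by (rule mult_left_mono)
      with bd[of z] False show ?thesis by (simp add: mult.assoc)
    qed (use M in simp)
  qed
  then show ?thesis by (simp add: mult.assoc)
qed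

lemma minus_involution_integral:
  fixes g :: "'a::euclidean_space \<Rightarrow> real"
  assumes "g \<in> borel_measurable borel"
  shows "(LINT z|lborel. g (- z)) = (LINT z|lborel. g z)"
    and "integrable lborel g \<Longrightarrow> integrable lborel (\<lambda>z. g (- z))"
  using integral_isometric_involution[of uminus g] assms by (simp_all add: dist_minus)

text \<open>Averaging with the integrand at \<open>- z\<close> replaces the principal value by an absolutely convergent integral
  of second differences.\<close>

lemma truncated_levy_tendsto:
  fixes A :: "real ^ 'n ^ 'n"
  assumes A: "A \<in> admissible \<theta> \<Theta> e" "0 < \<theta>" "\<theta> \<le> \<Theta>"
    and a: "real CARD('n) < a" "a < real CARD('n) + 2"
    and V: "V \<in> borel_measurable borel" and bd: "\<And>z. \<bar>V z\<bar> \<le> M"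
    and sd: "\<And>z. \<bar>V z + V (- z) - 2 * V 0\<bar> \<le> C * min 1 ((norm z)\<^sup>2)"
  shows "(truncated_levy A a V \<longlongrightarrow> levy_operator A a V) (at_right 0)"
proof (rule tendsto_at_right_sequentially[OF zero_less_one])
  fix S :: "nat \<Rightarrow> real" assume S: "\<And>n. 0 < S n" "S \<longlonglongrightarrow> 0"
  have [measurable]: "- ball (0 :: real ^ 'n) \<epsilon> \<in> sets borel" for \<epsilon> by (intro borel_comp) simp
  note V[measurable]
  have VM: "\<bar>V z - V 0\<bar> \<le> 2 * M" for z using bd[of z] bd[of 0] by linarith
  let ?D = "\<lambda>z. (V z + V (- z) - 2 * V 0) * levy_kernel A a z"
  have D: "integrable lborel ?D"
    by (rule integrable_const_levy_kernel(1)[OF A a _ sd]) measurable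
  have eq: "truncated_levy A a V \<epsilon> = (LINT z|lborel. indicator (- ball 0 \<epsilon>) z * ?D z) / 2" if "0 < \<epsilon>" for \<epsilon>
  proof -
    let ?g = "\<lambda>z. indicator (- ball 0 \<epsilon>) z * ((V z - V 0) * levy_kernel A a z)"
    have g: "integrable lborel ?g"
      by (rule integrable_truncated_levy[OF A a _ VM that]) measurable
    have gm: "?g \<in> borel_measurable borel" by measurable
    have "(LINT z|lborel. indicator (- ball 0 \<epsilon>) z * ?D z) = (LINT z|lborel. ?g z + ?g (- z))"
      by (rule Bochner_Integration.integral_cong) (auto simp: algebra_simps split: split_indicator)
    also have "\<dots> = (LINT z|lborel. ?g z) + (LINT z|lborel. ?g (- z))"
      by (rule Bochner_Integration.integral_add[OF g minus_involution_integral(2)[OF gm g]])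
    also have "\<dots> = 2 * truncated_levy A a V \<epsilon>"
      unfolding minus_involution_integral(1)[OF gm] by (simp add: truncated_levy_def)
    finally show ?thesis by simp
  qed
  have "(\<lambda>n. LINT z|lborel. indicator (- ball 0 (S n)) z * ?D z) \<longlonglongrightarrow> (LINT z|lborel. ?D z)"
  proof (rule integral_dominated_convergence[where w = "\<lambda>z. \<bar>?D z\<bar>"])
    show "AE z in lborel. (\<lambda>n. indicator (- ball 0 (S n)) z * ?D z) \<longlonglongrightarrow> ?D z"
    proof (rule AE_I2)
      fix z :: "real ^ 'n"
      show "(\<lambda>n. indicator (- ball 0 (S n)) z * ?D z) \<longlonglongrightarrow> ?D z"
      proof (cases "z = 0")
        case False
        then have "eventually (\<lambda>n. S n < norm z) sequentially"
          using order_tendstoD(2)[OF S(2), of "norm z"] by simp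
        then have "eventually (\<lambda>n. ?D z = indicator (- ball 0 (S n)) z * ?D z) sequentially"
          by eventually_elim simp
        then show ?thesis by (rule Lim_transform_eventually[OF tendsto_const])
      qed simp
    qed
    show "integrable lborel (\<lambda>z. \<bar>?D z\<bar>)" using D by (rule integrable_abs)
  qed (measurable, auto split: split_indicator)
  then have "(\<lambda>n. (LINT z|lborel. indicator (- ball 0 (S n)) z * ?D z) / 2) \<longlonglongrightarrow> levy_operator A a V"
    unfolding levy_operator_def by (intro tendsto_intros) auto
  then show "(\<lambda>n. truncated_levy A a V (S n)) \<longlonglongrightarrow> levy_operator A a V"
    by (simp add: eq S(1))
qed

text \<open>The integrand is Borel, so \<open>lebesgue\<close> may be replaced by
  \<open>lborel\<close>; translation by \<open>x\<close> moves the singularity to the origin, and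
  the existing limit determines \<open>Lim\<close>.\<close>

lemma pv_integral_eq_levy_operator:
  fixes A :: "real ^ 'n ^ 'n"
  assumes A: "A \<in> admissible \<theta> \<Theta> e" "0 < \<theta>" "\<theta> \<le> \<Theta>"
    and a: "real CARD('n) < a" "a < real CARD('n) + 2"
    and u: "continuous_on UNIV u" and bd: "\<And>z. \<bar>u z\<bar> \<le> M"
    and sd: "\<And>z. \<bar>u (x + z) + u (x - z) - 2 * u x\<bar> \<le> C * min 1 ((norm z)\<^sup>2)"
  shows "pv_integral x (\<lambda>y. (u y - u x) / norm (matrix_inv A *v (y - x)) powr a)
    = levy_operator A a (\<lambda>z. u (x + z))"
proof -
  have [measurable]: "- ball y \<epsilon> \<in> sets borel" for y :: "real ^ 'n" and \<epsilon> by (intro borel_comp) simp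
  have [measurable]: "u \<in> borel_measurable borel" by (rule borel_measurable_continuous_onI[OF u])
  have "(LINT y:- ball x \<epsilon>|lebesgue. (u y - u x) / norm (matrix_inv A *v (y - x)) powr a)
      = truncated_levy A a (\<lambda>z. u (x + z)) \<epsilon>" for \<epsilon>
  proof -
    let ?f = "\<lambda>y. indicator (- ball x \<epsilon>) y * ((u y - u x) * levy_kernel A a (y - x))"
    have f: "?f \<in> borel_measurable borel" by measurable
    have "(LINT y:- ball x \<epsilon>|lebesgue. (u y - u x) / norm (matrix_inv A *v (y - x)) powr a) = (LINT y|lebesgue. ?f y)"
      by (simp add: set_lebesgue_integral_def levy_kernel_def)
    also have "\<dots> = (LINT y|lborel. ?f y)"
      by (rule integral_completion) (simp add: f)
    also have "\<dots> = (LINT y|distr lborel borel ((+) x). ?f y)"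
      by (simp only: lborel_distr_plus)
    also have "\<dots> = (LINT z|lborel. ?f (x + z))"
      by (rule integral_distr) (simp_all add: f)
    also have "\<dots> = truncated_levy A a (\<lambda>z. u (x + z)) \<epsilon>"
      unfolding truncated_levy_def
      by (rule Bochner_Integration.integral_cong) (auto simp: dist_norm split: split_indicator)
    finally show ?thesis .
  qed
  moreover have "(truncated_levy A a (\<lambda>z. u (x + z)) \<longlongrightarrow> levy_operator A a (\<lambda>z. u (x + z))) (at_right 0)"
    by (rule truncated_levy_tendsto[OF A a _ bd, where C = C]) (use sd in simp_all)
  ultimately show ?thesis
    unfolding pv_integral_def by (simp add: tendsto_Lim)
qed

section \<open>Second differences of regular functions and the infimum over matrices\<close>

lemma C11_loc_continuous: "u \<in> C11_loc \<Longrightarrow> continuous_on UNIV u"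
  by (auto simp: C11_loc_def gderiv_def continuous_on_eq_continuous_at intro: has_derivative_continuous)

text \<open>For small \<open>z\<close> the mean value theorem on the segments towards
  \<open>x + z\<close> and \<open>x - z\<close> leaves a difference of gradients at points at most
  2|z| apart, which the Lipschitz condition bounds. For large \<open>z\<close> boundedness
  suffices.\<close>

lemma C11_loc_second_difference:
  fixes u :: "real ^ 'n \<Rightarrow> real"
  assumes u: "u \<in> C11_loc" and bd: "\<And>z. \<bar>u z\<bar> \<le> M"
  obtains C where "\<And>z. \<bar>u (x + z) + u (x - z) - 2 * u x\<bar> \<le> C * min 1 ((norm z)\<^sup>2)"
proof -
  obtain G where G: "\<And>y. GDERIV u y :> G y" and lip: "\<And>y. \<exists>r>0. \<exists>L. L-lipschitz_on (ball y r) G"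
    using u by (auto simp: C11_loc_def)
  obtain r L where r: "0 < r" and L: "L-lipschitz_on (ball x r) G" using lip by blast
  have L0: "0 \<le> L" using lipschitz_on_nonneg[OF L] .
  have near: "\<bar>u (x + z) + u (x - z) - 2 * u x\<bar> \<le> (2 * L) * (norm z)\<^sup>2" if z: "norm z < r" for z
  proof -
    have dline: "((\<lambda>t. u (x + t *\<^sub>R v)) has_real_derivative v \<bullet> G (x + t *\<^sub>R v)) (at t)" for v t
    proof -
      have "((\<lambda>t. u (x + t *\<^sub>R v)) has_derivative (\<lambda>h. (h *\<^sub>R v) \<bullet> G (x + t *\<^sub>R v))) (at t)"
        by (rule has_derivative_compose[where f = "\<lambda>t. x + t *\<^sub>R v" and g = u,
              OF _ G[of "x + t *\<^sub>R v", unfolded gderiv_def]])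
          (auto intro!: derivative_eq_intros)
      then show ?thesis by (simp add: has_field_derivative_def mult_commute_abs)
    qed
    have mv: "\<exists>y\<in>ball x r. u (x + v) - u x = v \<bullet> G y \<and> dist y x \<le> norm z" if v: "norm v = norm z" for v
    proof -
      obtain t where t: "0 < t" "t < 1" and eq: "u (x + 1 *\<^sub>R v) - u (x + 0 *\<^sub>R v) = (1 - 0) * (v \<bullet> G (x + t *\<^sub>R v))"
        using MVT2[of 0 1 "\<lambda>t. u (x + t *\<^sub>R v)" "\<lambda>t. v \<bullet> G (x + t *\<^sub>R v)"] dline by auto
      have "norm (t *\<^sub>R v) \<le> norm z" using t v by (simp add: mult_left_le_one_le)
      then show ?thesis using eq z by (intro bexI[of _ "x + t *\<^sub>R v"]) (auto simp: dist_norm)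
    qed
    obtain y where y: "y \<in> ball x r" "u (x + z) - u x = z \<bullet> G y" "dist y x \<le> norm z" using mv[of z] by auto
    obtain y' where y': "y' \<in> ball x r" "u (x + - z) - u x = - z \<bullet> G y'" "dist y' x \<le> norm z" using mv[of "- z"] by auto
    have "u (x + z) + u (x - z) - 2 * u x = z \<bullet> (G y - G y')"
      using y y' by (simp add: inner_diff_right)
    also have "\<bar>\<dots>\<bar> \<le> norm z * norm (G y - G y')" by (rule Cauchy_Schwarz_ineq2)
    also have "\<dots> \<le> norm z * (L * dist y y')"
      using lipschitz_onD[OF L y(1) y'(1)] by (intro mult_left_mono) (auto simp: dist_norm)
    also have "\<dots> \<le> norm z * (L * (2 * norm z))"
      using dist_triangle2[of y y' x] y y' L0 by (intro mult_left_mono) auto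
    finally show ?thesis by (simp add: power2_eq_square mult_ac)
  qed
  \<comment> \<open>\<open>2 * L\<close> serves \<open>norm z < r\<close>,
    \<open>4 * M / r\<^sup>2\<close> the complement, and \<open>4 * M\<close> the bound by the
    constant 1 in the minimum.\<close>
  define C where "C = max (max (2 * L) (4 * M)) (4 * M / r\<^sup>2)"
  have M0: "0 \<le> M" using bd[of 0] by linarith
  have all: "\<bar>u (x + z) + u (x - z) - 2 * u x\<bar> \<le> 4 * M" for z
    using bd[of "x + z"] bd[of "x - z"] bd[of x] by linarith
  have "\<bar>u (x + z) + u (x - z) - 2 * u x\<bar> \<le> C * (norm z)\<^sup>2" for z
  proof (cases "norm z < r")
    case True
    show ?thesis by (rule order_trans[OF near[OF True]]) (auto simp: C_def intro!: mult_right_mono)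
  next
    case False
    then have "r\<^sup>2 \<le> (norm z)\<^sup>2" using r by (intro power_mono) auto
    then have "4 * M \<le> 4 * M / r\<^sup>2 * (norm z)\<^sup>2" using M0 r by (simp add: field_simps mult_left_mono)
    also have "\<dots> \<le> C * (norm z)\<^sup>2" unfolding C_def by (rule mult_right_mono) auto
    finally show ?thesis using all[of z] by linarith
  qed
  moreover have "\<bar>u (x + z) + u (x - z) - 2 * u x\<bar> \<le> C" for z
    using all[of z] by (simp add: C_def)
  ultimately have "\<bar>u (x + z) + u (x - z) - 2 * u x\<bar> \<le> C * min 1 ((norm z)\<^sup>2)" for z
    by (simp add: min_def)
  then show ?thesis by (rule that)
qed

text \<open>The infimum is used only through these facts; almost minimising matrices stand in for a
  minimiser. Nonemptiness and the uniform lower bound make the real-valued \<open>INF\<close> a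
  genuine infimum.\<close>

lemma Fs_extremal:
  fixes u :: "real ^ 'n \<Rightarrow> real"
  assumes s: "0 < s" "s < 1" and \<theta>: "0 < \<theta>" "\<theta> \<le> \<Theta>" and e: "norm e = 1"
    and u: "u \<in> C11_loc" and bd: "\<And>z. \<bar>u z\<bar> \<le> M"
  defines "a \<equiv> real CARD('n) + 2 * s"
  shows "A \<in> admissible \<theta> \<Theta> e \<Longrightarrow> Fs s \<theta> \<Theta> e u x \<le> levy_operator A a (\<lambda>z. u (x + z))"
    and "0 < \<eta> \<Longrightarrow> \<exists>A\<in>admissible \<theta> \<Theta> e. levy_operator A a (\<lambda>z. u (x + z)) < Fs s \<theta> \<Theta> e u x + \<eta>"
    and "A \<in> admissible \<theta> \<Theta> e \<Longrightarrow>
      (truncated_levy A a (\<lambda>z. u (x + z)) \<longlongrightarrow> levy_operator A a (\<lambda>z. u (x + z))) (at_right 0)"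
proof -
  have a: "real CARD('n) < a" "a < real CARD('n) + 2" using s by (auto simp: a_def)
  have cont: "continuous_on UNIV u" using u by (rule C11_loc_continuous)
  obtain C where C: "\<And>z. \<bar>u (x + z) + u (x - z) - 2 * u x\<bar> \<le> C * min 1 ((norm z)\<^sup>2)"
    using C11_loc_second_difference[OF u bd] by metis
  have [measurable]: "u \<in> borel_measurable borel" by (rule borel_measurable_continuous_onI[OF cont])
  let ?L = "\<lambda>A. levy_operator A a (\<lambda>z. u (x + z))"
  have Fs: "Fs s \<theta> \<Theta> e u x = (INF A\<in>admissible \<theta> \<Theta> e. ?L A)"
    unfolding Fs_def by (intro INF_cong refl) (use pv_integral_eq_levy_operator[OF _ \<theta> a cont bd C] in \<open>simp add: a_def\<close>)
  let ?B = "C * \<Theta> powr a * (LINT z|lborel. min 1 ((norm z)\<^sup>2) / norm (z :: real ^ 'n) powr a)"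
  have "- (?B / 2) \<le> ?L A" if "A \<in> admissible \<theta> \<Theta> e" for A
  proof -
    have "\<bar>LINT z|lborel. (u (x + z) + u (x - z) - 2 * u x) * levy_kernel A a z\<bar> \<le> ?B"
      by (rule integrable_const_levy_kernel(2)[OF that \<theta> a _ C]) measurable
    then show ?thesis by (simp add: levy_operator_def abs_le_iff)
  qed
  then have bb: "bdd_below (?L ` admissible \<theta> \<Theta> e)" by (intro bdd_belowI2)
  have ne: "admissible \<theta> \<Theta> e \<noteq> {}" using admissible_nonempty[OF \<theta> e] by auto
  show "Fs s \<theta> \<Theta> e u x \<le> ?L A" if "A \<in> admissible \<theta> \<Theta> e"
    unfolding Fs using bb that by (rule cINF_lower)
  show "\<exists>A\<in>admissible \<theta> \<Theta> e. ?L A < Fs s \<theta> \<Theta> e u x + \<eta>" if "0 < \<eta>"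
    unfolding Fs using that by (intro cINF_less_iff[THEN iffD1, OF ne bb]) simp
  show "(truncated_levy A a (\<lambda>z. u (x + z)) \<longlongrightarrow> ?L A) (at_right 0)" if "A \<in> admissible \<theta> \<Theta> e"
    by (rule truncated_levy_tendsto[OF that \<theta> a _ bd, where C = C]) (use C in simp_all)
qed

section \<open>Comparison at a minimum\<close>

text \<open>Two views of a reflected displacement: around the image point it is the linear
  reflection \<open>mirror e 0\<close>, while seen from \<open>x\<close> it is reflection in a plane
  at signed distance \<open>l - x \<bullet> e\<close>.\<close>

lemma mirror_add: "mirror e l (x + z) = mirror e l x + mirror e 0 z"
  by (simp add: mirror_def inner_add_left algebra_simps)

lemma mirror_add': "mirror e l (x + z) = x + mirror e (l - x \<bullet> e) z"
  by (simp add: mirror_def inner_add_left algebra_simps)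

lemma norm_mirror_0: "norm e = 1 \<Longrightarrow> norm (mirror e 0 z) = norm z"
  using dist_mirror[of e 0 z 0] by (simp add: mirror_def)

lemma mirror_measurable [measurable]: "mirror e c \<in> borel_measurable borel"
  by (intro borel_measurable_continuous_onI continuous_intros)

text \<open>The linear reflection preserves the ball, Lebesgue measure and the kernel. The operator
  at the mirror image of \<open>x\<close> may thus be evaluated with reflected displacements, which
  turns the difference of the two operators into one operator applied to \<open>w l\<close>.\<close>

lemma truncated_levy_mirror:
  fixes A :: "real ^ 'n ^ 'n"
  assumes A: "A \<in> admissible \<theta> \<Theta> e" "0 < \<theta>" and e: "norm e = 1" and V: "V \<in> borel_measurable borel"
  shows "truncated_levy A a (\<lambda>z. V (mirror e 0 z)) \<epsilon> = truncated_levy A a V \<epsilon>"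
proof -
  have [measurable]: "- ball (0 :: real ^ 'n) \<epsilon> \<in> sets borel" by (intro borel_comp) simp
  note V[measurable]
  let ?g = "\<lambda>z. indicator (- ball 0 \<epsilon>) z * ((V z - V 0) * levy_kernel A a z)"
  have "truncated_levy A a (\<lambda>z. V (mirror e 0 z)) \<epsilon> = (LINT z|lborel. ?g (mirror e 0 z))"
    unfolding truncated_levy_def
    by (rule Bochner_Integration.integral_cong)
      (auto simp: levy_kernel_mirror_0[OF A e] norm_mirror_0 e mirror_def[of e 0 0] split: split_indicator)
  also have "\<dots> = (LINT z|lborel. ?g z)"
    by (rule integral_isometric_involution(1)) (simp_all add: dist_mirror e)
  finally show ?thesis by (simp add: truncated_levy_def)
qed

lemma truncated_levy_diff:
  fixes A :: "real ^ 'n ^ 'n"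
  assumes A: "A \<in> admissible \<theta> \<Theta> e" "0 < \<theta>" "\<theta> \<le> \<Theta>"
    and a: "real CARD('n) < a" "a < real CARD('n) + 2"
    and V: "V \<in> borel_measurable borel" "\<And>z. \<bar>V z\<bar> \<le> M"
    and W: "W \<in> borel_measurable borel" "\<And>z. \<bar>W z\<bar> \<le> M" and \<epsilon>: "0 < \<epsilon>"
  shows "truncated_levy A a (\<lambda>z. V z - W z) \<epsilon> = truncated_levy A a V \<epsilon> - truncated_levy A a W \<epsilon>"
proof -
  note V(1)[measurable] W(1)[measurable]
  have int: "integrable lborel (\<lambda>z. indicator (- ball 0 \<epsilon>) z * ((V z - V 0) * levy_kernel A a z))"
    "integrable lborel (\<lambda>z. indicator (- ball 0 \<epsilon>) z * ((W z - W 0) * levy_kernel A a z))"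
  proof -
    have "\<bar>V z - V 0\<bar> \<le> 2 * M" "\<bar>W z - W 0\<bar> \<le> 2 * M" for z
      using V(2)[of z] V(2)[of 0] W(2)[of z] W(2)[of 0] by linarith+
    then show "integrable lborel (\<lambda>z. indicator (- ball 0 \<epsilon>) z * ((V z - V 0) * levy_kernel A a z))"
      "integrable lborel (\<lambda>z. indicator (- ball 0 \<epsilon>) z * ((W z - W 0) * levy_kernel A a z))"
      by (auto intro!: integrable_truncated_levy[OF A a _ _ \<epsilon>])
  qed
  show ?thesis unfolding truncated_levy_def
    by (subst Bochner_Integration.integral_diff[OF int, symmetric])
      (auto intro!: Bochner_Integration.integral_cong simp: algebra_simps)
qed

text \<open>For antisymmetric \<open>V\<close> with a nonpositive minimum over the half space at the origin, every
  reflected pair of points contributes a nonnegative amount, except close to the origin.\<close>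

lemma truncated_levy_antisymmetric:
  fixes A :: "real ^ 'n ^ 'n"
  assumes A: "A \<in> admissible \<theta> \<Theta> e" "0 < \<theta>" "\<theta> \<le> \<Theta>" and e: "norm e = 1"
    and a: "real CARD('n) < a" "a < real CARD('n) + 2"
    and V: "V \<in> borel_measurable borel" "\<And>z. \<bar>V z\<bar> \<le> M"
    and \<delta>: "0 < \<delta>" and anti: "\<And>z. V (mirror e \<delta> z) = - V z"
    and V0: "V 0 \<le> 0" and mn: "\<And>z. z \<bullet> e \<le> \<delta> \<Longrightarrow> V 0 \<le> V z"
    and S: "\<And>z. z \<in> ball p r \<Longrightarrow> z \<bullet> e < \<delta> \<and> \<rho> \<le> norm z"
    and \<kappa>: "\<And>z. z \<in> ball p r \<Longrightarrow> \<kappa> \<le> (V z - V 0) * (levy_kernel A a z - levy_kernel A a (mirror e \<delta> z))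
        - 2 * V 0 * levy_kernel A a (mirror e \<delta> z)"
    and \<epsilon>: "0 < \<epsilon>" "\<epsilon> \<le> \<delta>" "\<epsilon> \<le> \<rho>"
  shows "\<kappa> * measure lborel (ball p r) - 2 * M * \<Theta> powr a / \<delta> powr a * measure lborel (ball 0 \<epsilon> :: (real ^ 'n) set)
    \<le> truncated_levy A a V \<epsilon>"
proof -
  have a0: "0 < a" using a by (smt (verit) of_nat_0_le_iff)
  have [measurable]: "- ball y t \<in> sets borel" "ball y t \<in> sets borel" for y :: "real ^ 'n" and t
    by (auto intro: borel_comp)
  note V(1)[measurable]
  \<comment> \<open>The price of truncation: a point within \<epsilon> of the origin is removed
    while its mirror image, at distance at least \<delta>, is kept, and that image alone may
    contribute as little as \<open>- B\<close>.\<close>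
  define B where "B = 2 * M * \<Theta> powr a / \<delta> powr a"
  let ?\<rho> = "mirror e \<delta>"
  let ?g = "\<lambda>z. indicator (- ball 0 \<epsilon>) z * ((V z - V 0) * levy_kernel A a z)"
  let ?h = "\<lambda>z. \<kappa> * indicator (ball p r) z - B * indicator (ball 0 \<epsilon>) z :: real"
  \<comment> \<open>Both integrals are invariant under reflection, so the inequality is needed only
    for sums over reflected pairs. Away from the small ball such a sum is the expression bounded
    below by \<kappa> in the hypothesis.\<close>
  have sum_le: "?h z + ?h (?\<rho> z) \<le> ?g z + ?g (?\<rho> z)" if z: "z \<bullet> e \<le> \<delta>" for z
  proof -
    have "\<delta> \<le> ?\<rho> z \<bullet> e" using z e by simp
    also have "\<dots> \<le> norm (?\<rho> z)" using norm_cauchy_schwarz[of "?\<rho> z" e] e by simp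
    finally have far: "\<delta> \<le> norm (?\<rho> z)" .
    have "?\<rho> z \<notin> ball p r" using S[of "?\<rho> z"] z e by auto
    then have h\<rho>: "?h (?\<rho> z) = 0" using far \<epsilon> by simp
    have g\<rho>: "?g (?\<rho> z) = (- V z - V 0) * levy_kernel A a (?\<rho> z)" using far \<epsilon> by (simp add: anti)
    show ?thesis
    proof (cases "norm z < \<epsilon>")
      case True
      then have hz: "?h z = - B" "?g z = 0" using S[of z] \<epsilon> by (auto simp: indicator_def)
      have "(V z + V 0) * levy_kernel A a (?\<rho> z) \<le> (2 * M) * (\<Theta> powr a / \<delta> powr a)"
      proof (rule mult_mono)
        show "V z + V 0 \<le> 2 * M" using V(2)[of z] V(2)[of 0] by linarith
        have "levy_kernel A a (?\<rho> z) \<le> \<Theta> powr a / norm (?\<rho> z) powr a" by (rule levy_kernel_le[OF A a0])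
        also have "\<dots> \<le> \<Theta> powr a / \<delta> powr a"
          using far \<delta> a0 by (intro divide_left_mono powr_mono2 mult_pos_pos) auto
        finally show "levy_kernel A a (?\<rho> z) \<le> \<Theta> powr a / \<delta> powr a" .
        show "0 \<le> 2 * M" using V(2)[of 0] by linarith
      qed simp
      then show ?thesis unfolding h\<rho> g\<rho> hz by (simp add: B_def algebra_simps)
    next
      case False
      then have z0: "z \<noteq> 0" using \<epsilon> by auto
      have g: "?g z + ?g (?\<rho> z) = (V z - V 0) * (levy_kernel A a z - levy_kernel A a (?\<rho> z))
          - 2 * V 0 * levy_kernel A a (?\<rho> z)"
        unfolding g\<rho> using False by (simp add: algebra_simps)
      have "0 \<le> (V z - V 0) * (levy_kernel A a z - levy_kernel A a (?\<rho> z))"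
        using mn[OF z] levy_kernel_mirror_le[OF A(1,2) e a0 _ z z0] \<delta> by (intro mult_nonneg_nonneg) auto
      moreover have "2 * V 0 * levy_kernel A a (?\<rho> z) \<le> 0" using V0 by (simp add: mult_nonpos_nonneg)
      ultimately have "?h z \<le> (V z - V 0) * (levy_kernel A a z - levy_kernel A a (?\<rho> z))
          - 2 * V 0 * levy_kernel A a (?\<rho> z)"
        using False \<kappa>[of z] by (cases "z \<in> ball p r") auto
      then show ?thesis unfolding g h\<rho> by simp
    qed
  qed
  have sum_le': "?h z + ?h (?\<rho> z) \<le> ?g z + ?g (?\<rho> z)" for z
  proof (cases "z \<bullet> e \<le> \<delta>")
    case False
    then show ?thesis using sum_le[of "?\<rho> z"] e by simp
  qed (rule sum_le)
  have g: "integrable lborel ?g"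
  proof (rule integrable_truncated_levy[OF A a _ _ \<epsilon>(1)])
    show "\<bar>V z - V 0\<bar> \<le> 2 * M" for z using V(2)[of z] V(2)[of 0] by linarith
  qed measurable
  have ib: "integrable lborel (indicat_real (ball y t))" for y :: "real ^ 'n" and t
    by (rule integrable_real_indicator) (auto intro: emeasure_bounded_finite simp flip: infinity_ennreal_def)
  have h: "integrable lborel ?h"
    by (intro Bochner_Integration.integrable_diff integrable_mult_right ib)
  have dbl: "integrable lborel (\<lambda>z. f z + f (?\<rho> z)) \<and> (LINT z|lborel. f z + f (?\<rho> z)) = 2 * (LINT z|lborel. f z)"
    if f: "integrable lborel f" for f :: "real ^ 'n \<Rightarrow> real"
  proof -
    have m: "f \<in> borel_measurable borel" using f by (auto dest: borel_measurable_integrable)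
    have "integrable lborel (\<lambda>z. f (?\<rho> z))" "(LINT z|lborel. f (?\<rho> z)) = (LINT z|lborel. f z)"
      using integral_isometric_involution[of ?\<rho> f] f m by (simp_all add: dist_mirror e)
    with f show ?thesis by simp
  qed
  have "(LINT z|lborel. ?h z + ?h (?\<rho> z)) \<le> (LINT z|lborel. ?g z + ?g (?\<rho> z))"
    by (intro integral_mono sum_le' dbl[OF h, THEN conjunct1] dbl[OF g, THEN conjunct1])
  then have "(LINT z|lborel. ?h z) \<le> (LINT z|lborel. ?g z)"
    using dbl[OF h] dbl[OF g] by linarith
  moreover have "(LINT z|lborel. ?h z) = \<kappa> * measure lborel (ball p r) - B * measure lborel (ball 0 \<epsilon> :: (real ^ 'n) set)"
    by (subst Bochner_Integration.integral_diff) (auto intro!: integrable_mult_right ib)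
  ultimately show ?thesis by (simp add: B_def truncated_levy_def)
qed

text \<open>The same matrix serves both points: almost optimal at the mirror image of
  \<open>x\<close>, merely admissible at \<open>x\<close>. Hence \<kappa> has to be a bound for
  every matrix.\<close>

lemma Fs_comparison:
  fixes u :: "real ^ 'n \<Rightarrow> real"
  assumes s: "0 < s" "s < 1" and \<theta>: "0 < \<theta>" "\<theta> \<le> \<Theta>" and e: "norm e = 1"
    and u: "u \<in> C11_loc" and bd: "\<And>z. \<bar>u z\<bar> \<le> M"
  defines "a \<equiv> real CARD('n) + 2 * s"
  defines "w \<equiv> \<lambda>l y. u (mirror e l y) - u y"
  assumes \<delta>: "0 < \<delta>" "\<delta> = l - x \<bullet> e"
    and x: "w l x \<le> 0" "\<And>y. y \<bullet> e \<le> l \<Longrightarrow> w l x \<le> w l y"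
    and S: "\<And>z. z \<in> ball p r \<Longrightarrow> z \<bullet> e < \<delta> \<and> \<rho> \<le> norm z" and \<rho>: "0 < \<rho>"
    and \<kappa>: "\<And>A z. A \<in> admissible \<theta> \<Theta> e \<Longrightarrow> z \<in> ball p r \<Longrightarrow>
      \<kappa> \<le> (w l (x + z) - w l x) * (levy_kernel A a z - levy_kernel A a (mirror e \<delta> z))
        - 2 * w l x * levy_kernel A a (mirror e \<delta> z)"
  shows "\<kappa> * measure lborel (ball p r) \<le> Fs s \<theta> \<Theta> e u (mirror e l x) - Fs s \<theta> \<Theta> e u x"
proof -
  have a: "real CARD('n) < a" "a < real CARD('n) + 2" using s by (auto simp: a_def)
  have cont: "continuous_on UNIV u" using u by (rule C11_loc_continuous)
  have [measurable]: "u \<in> borel_measurable borel" by (rule borel_measurable_continuous_onI[OF cont])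
  note ext = Fs_extremal[OF s \<theta> e u bd, folded a_def]
  define V where "V = (\<lambda>z. w l (x + z))"
  have V_eq: "V = (\<lambda>z. u (mirror e l x + mirror e 0 z) - u (x + z))"
    by (simp add: V_def w_def mirror_add)
  have Vm: "V \<in> borel_measurable borel" unfolding V_eq by measurable
  have Vb: "\<bar>V z\<bar> \<le> 2 * M" for z
    using bd[of "mirror e l x + mirror e 0 z"] bd[of "x + z"] by (simp add: V_eq)
  have anti: "V (mirror e \<delta> z) = - V z" for z
    using e by (simp add: V_def w_def \<delta>(2) mirror_add'[symmetric])
  have low: "\<kappa> * measure lborel (ball p r)
      \<le> levy_operator A a (\<lambda>z. u (mirror e l x + z)) - levy_operator A a (\<lambda>z. u (x + z))"
    if A: "A \<in> admissible \<theta> \<Theta> e" for A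
  proof (rule tendsto_le)
    let ?B = "2 * (2 * M) * \<Theta> powr a / \<delta> powr a"
    show "((\<lambda>\<epsilon>. truncated_levy A a (\<lambda>z. u (mirror e l x + z)) \<epsilon> - truncated_levy A a (\<lambda>z. u (x + z)) \<epsilon>)
        \<longlongrightarrow> levy_operator A a (\<lambda>z. u (mirror e l x + z)) - levy_operator A a (\<lambda>z. u (x + z))) (at_right 0)"
      by (intro tendsto_diff ext(3) A)
    have "((\<lambda>\<epsilon>. \<kappa> * measure lborel (ball p r) - ?B * (unit_ball_vol (real CARD('n)) * \<epsilon> ^ CARD('n)))
        \<longlongrightarrow> \<kappa> * measure lborel (ball p r) - ?B * (unit_ball_vol (real CARD('n)) * 0 ^ CARD('n))) (at_right 0)"
      by (intro tendsto_intros)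
    then show "((\<lambda>\<epsilon>. \<kappa> * measure lborel (ball p r) - ?B * (unit_ball_vol (real CARD('n)) * \<epsilon> ^ CARD('n)))
        \<longlongrightarrow> \<kappa> * measure lborel (ball p r)) (at_right 0)"
      by (simp add: zero_power)
    \<comment> \<open>The truncation radius has to stay below the distance to the plane and clear of
      the ball that carries \<kappa>; the truncation loss is of order \<epsilon>^n.\<close>
    have "eventually (\<lambda>\<epsilon>. \<epsilon> \<in> {0<..<min \<delta> \<rho>}) (at_right 0)"
      using \<delta> \<rho> by (intro eventually_at_right_real) auto
    then show "eventually (\<lambda>\<epsilon>. \<kappa> * measure lborel (ball p r) - ?B * (unit_ball_vol (real CARD('n)) * \<epsilon> ^ CARD('n))
        \<le> truncated_levy A a (\<lambda>z. u (mirror e l x + z)) \<epsilon> - truncated_levy A a (\<lambda>z. u (x + z)) \<epsilon>) (at_right 0)"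
    proof eventually_elim
      case (elim \<epsilon>)
      have "\<kappa> * measure lborel (ball p r) - ?B * measure lborel (ball 0 \<epsilon> :: (real ^ 'n) set) \<le> truncated_levy A a V \<epsilon>"
      proof (rule truncated_levy_antisymmetric[OF A \<theta> e a Vm Vb \<delta>(1) anti _ _ S])
        show "V 0 \<le> 0" using x by (simp add: V_def)
        show "V 0 \<le> V z" if "z \<bullet> e \<le> \<delta>" for z
          using x(2)[of "x + z"] that \<delta> by (simp add: V_def inner_add_left)
        show "\<kappa> \<le> (V z - V 0) * (levy_kernel A a z - levy_kernel A a (mirror e \<delta> z))
            - 2 * V 0 * levy_kernel A a (mirror e \<delta> z)" if "z \<in> ball p r" for z
          using \<kappa>[OF A that] by (simp add: V_def)
      qed (use elim in auto)
      also have "truncated_levy A a V \<epsilon> = truncated_levy A a (\<lambda>z. u (mirror e l x + mirror e 0 z)) \<epsilon>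
          - truncated_levy A a (\<lambda>z. u (x + z)) \<epsilon>"
        unfolding V_eq using elim by (intro truncated_levy_diff[OF A \<theta> a _ bd _ bd]) auto
      also have "truncated_levy A a (\<lambda>z. u (mirror e l x + mirror e 0 z)) \<epsilon>
          = truncated_levy A a (\<lambda>z. u (mirror e l x + z)) \<epsilon>"
        by (rule truncated_levy_mirror[OF A \<theta>(1) e, where V = "\<lambda>z. u (mirror e l x + z)"]) measurable
      finally show ?case using elim by (simp add: content_ball)
    qed
  qed simp
  show ?thesis
  proof (rule field_le_epsilon)
    fix \<eta> :: real assume "0 < \<eta>"
    then obtain A where A: "A \<in> admissible \<theta> \<Theta> e"
      and "levy_operator A a (\<lambda>z. u (mirror e l x + z)) < Fs s \<theta> \<Theta> e u (mirror e l x) + \<eta>"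
      using ext(2) by blast
    with low[OF A] ext(1)[OF A, of x]
    show "\<kappa> * measure lborel (ball p r) \<le> Fs s \<theta> \<Theta> e u (mirror e l x) - Fs s \<theta> \<Theta> e u x + \<eta>"
      by linarith
  qed
qed

section \<open>Decay at infinity\<close>

text \<open>A truncated paraboloid is added to \<open>u\<close> so that the perturbed function attains its maximum near \<open>x\<^sub>0\<close>.\<close>

lemma almost_maximum_second_difference:
  fixes u :: "'a::euclidean_space \<Rightarrow> real"
  assumes u: "continuous_on UNIV u" and \<epsilon>: "0 < \<epsilon>"
    and out: "\<And>y. R \<le> norm y \<Longrightarrow> u y < l + \<epsilon>"
    and x0: "R + 1 \<le> norm x\<^sub>0" "l - \<epsilon> < u x\<^sub>0"
  obtains x where "dist x\<^sub>0 x \<le> 1" "l - \<epsilon> < u x" "u x < l + \<epsilon>"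
    "\<And>z. R \<le> norm (x + z) \<Longrightarrow> R \<le> norm (x - z) \<Longrightarrow> u (x + z) + u (x - z) - 2 * u x \<le> 6 * \<epsilon> * min 1 ((norm z)\<^sup>2)"
proof -
  define q where "q = (\<lambda>y. 1 - (norm (y - x\<^sub>0))\<^sup>2)"
  \<comment> \<open>The height 3 \<epsilon> lifts the value at \<open>x\<^sub>0\<close> above l + 2
    \<epsilon>, beyond the bound l + \<epsilon> for \<open>u\<close> off the bump, so the maximum
    lies where \<open>q\<close> is positive. Removing the bump again costs at most 3 \<epsilon>,
    whence \<open>l - \<epsilon> < u x\<close>.\<close>
  define v where "v = (\<lambda>y. u y + 3 * \<epsilon> * max 0 (q y))"
  have vc: "continuous_on UNIV v" unfolding v_def q_def by (intro continuous_intros u)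
  have "\<exists>x\<in>cball x\<^sub>0 1. \<forall>y\<in>cball x\<^sub>0 1. v y \<le> v x"
    by (rule continuous_attains_sup) (auto intro: continuous_on_subset[OF vc])
  then obtain x where x: "x \<in> cball x\<^sub>0 1" and mx: "\<And>y. y \<in> cball x\<^sub>0 1 \<Longrightarrow> v y \<le> v x"
    by blast
  have vx: "l + 2 * \<epsilon> < v x" using mx[of x\<^sub>0] x0 by (simp add: v_def q_def)
  have "R \<le> norm x" using x0(1) x norm_triangle_ineq2[of x\<^sub>0 x] by (simp add: dist_norm)
  then have ux: "u x < l + \<epsilon>" by (rule out)
  have qx: "0 < q x"
  proof (rule ccontr)
    assume "\<not> 0 < q x"
    then have "v x = u x" by (simp add: v_def)
    then show False using vx ux \<epsilon> by simp
  qed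
  have q1: "q x \<le> 1" by (simp add: q_def)
  then have "3 * \<epsilon> * q x \<le> 3 * \<epsilon>" using \<epsilon> by simp
  then have lx: "l - \<epsilon> < u x" using vx qx by (simp add: v_def)
  have glob: "v y \<le> v x" if "R \<le> norm y" for y
  proof (cases "y \<in> cball x\<^sub>0 1")
    case False
    then have "1 \<le> (norm (y - x\<^sub>0))\<^sup>2" by (simp add: dist_norm norm_minus_commute one_le_power)
    then have "v y = u y" by (simp add: v_def q_def)
    then show ?thesis using out[OF that] vx \<epsilon> by simp
  qed (rule mx)
  have "u (x + z) + u (x - z) - 2 * u x \<le> 6 * \<epsilon> * min 1 ((norm z)\<^sup>2)"
    if "R \<le> norm (x + z)" "R \<le> norm (x - z)" for z
  proof -
    \<comment> \<open>Maximality of \<open>v x\<close> outside the ball of radius \<open>R\<close>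
      bounds the second difference of \<open>u\<close> by 3 \<epsilon> times this. Each maximum is
      at least 0, which gives the bound 2, and at least the value of \<open>q\<close>, which gives 2
      |z|^2.\<close>
    let ?d = "2 * q x - max 0 (q (x + z)) - max 0 (q (x - z))"
    have le: "u (x + z) + u (x - z) - 2 * u x \<le> 3 * \<epsilon> * ?d"
      using glob[OF that(1)] glob[OF that(2)] qx by (simp add: v_def algebra_simps)
    have "?d \<le> 2" using q1 by linarith
    moreover have "q (x + z) + q (x - z) = 2 * q x - 2 * (norm z)\<^sup>2"
    proof -
      have "x + z - x\<^sub>0 = (x - x\<^sub>0) + z" "x - z - x\<^sub>0 = (x - x\<^sub>0) - z" by simp_all
      then show ?thesis
        unfolding q_def by (simp only: power2_norm_eq_inner) (simp add: inner_add_left inner_add_right inner_diff_left inner_diff_right inner_commute)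
    qed
    then have "?d \<le> 2 * (norm z)\<^sup>2" by linarith
    ultimately have "?d \<le> 2 * min 1 ((norm z)\<^sup>2)" by linarith
    then have "3 * \<epsilon> * ?d \<le> 3 * \<epsilon> * (2 * min 1 ((norm z)\<^sup>2))"
      using \<epsilon> by (intro mult_left_mono) auto
    with le show ?thesis by linarith
  qed
  with x lx ux show ?thesis by (intro that[of x]) auto
qed

text \<open>The weight of displacements so large that \<open>x + z\<close> or \<open>x - z\<close>
  may enter the ball where only boundedness of \<open>u\<close> is known.\<close>

lemma levy_tail_tendsto_0:
  fixes a :: real
  assumes a: "real (DIM('a::euclidean_space)) < a" "a < real (DIM('a)) + 2"
  shows "(\<lambda>n. LINT z|lborel. indicator (- ball 0 (real n)) z * (min 1 ((norm z)\<^sup>2) / norm (z :: 'a) powr a)) \<longlonglongrightarrow> 0"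
proof -
  let ?m = "\<lambda>z :: 'a. min 1 ((norm z)\<^sup>2) / norm z powr a"
  have [measurable]: "- ball (0 :: 'a) t \<in> sets borel" for t by (intro borel_comp) simp
  have "(\<lambda>n. LINT z|lborel. indicator (- ball 0 (real n)) z * ?m z) \<longlonglongrightarrow> (LINT z|(lborel :: 'a measure). 0)"
  proof (rule integral_dominated_convergence[where w = ?m])
    show "AE z in lborel. (\<lambda>n. indicator (- ball 0 (real n)) z * ?m z) \<longlonglongrightarrow> 0"
    proof (rule AE_I2)
      fix z :: 'a
      have "eventually (\<lambda>n. norm z < real n) sequentially"
        using reals_Archimedean2[of "norm z"] by (auto simp: eventually_sequentially) (metis less_le_trans of_nat_le_iff)
      then have "eventually (\<lambda>n. 0 = indicator (- ball 0 (real n)) z * ?m z) sequentially"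
        by eventually_elim simp
      then show "(\<lambda>n. indicator (- ball 0 (real n)) z * ?m z) \<longlonglongrightarrow> 0"
        by (rule Lim_transform_eventually[OF tendsto_const])
    qed
    show "integrable lborel ?m" using a by (rule integrable_levy_kernel)
  qed (measurable, auto split: split_indicator)
  then show ?thesis by simp
qed

lemma powr_threshold_less_1:
  fixes p t :: real
  assumes "1 < p" "0 < t" "t < (1 / p) powr (1 / (p - 1))"
  shows "t powr p < t"
proof -
  have "(1 / p) powr (1 / (p - 1)) \<le> 1" using assms by (intro powr_le1) auto
  then have "t < 1" using assms by linarith
  then have "t powr p < t powr 1" using assms by (intro powr_less_mono') auto
  then show ?thesis using assms by simp
qed

text \<open>If \<open>l\<close> were positive, \<open>u - u powr p\<close> would be close to
  \<open>l - l powr p > 0\<close> at suitable remote points, while the almost flat second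
  differences there bound \<open>Fs\<close> above by a quarter of that value.\<close>

lemma solution_vanishes_at_infinity:
  fixes u :: "real ^ 'n \<Rightarrow> real"
  assumes s: "0 < s" "s < 1" and \<theta>: "0 < \<theta>" "\<theta> \<le> \<Theta>" and e: "norm e = 1" and p: "1 < p"
    and u: "u \<in> C11_loc" and u0: "\<And>x. 0 \<le> u x"
    and eq: "\<And>x. - Fs s \<theta> \<Theta> e u x + u x = u x powr p"
    and lim: "Limsup at_infinity (\<lambda>x. ereal (u x)) = ereal l"
    and l: "l < (1 / p) powr (1 / (p - 1))"
  shows "\<exists>M. \<forall>x. u x \<le> M" and "(u \<longlongrightarrow> 0) at_infinity"
proof -
  define a where "a = real CARD('n) + 2 * s"
  have a: "real CARD('n) < a" "a < real CARD('n) + 2" using s by (auto simp: a_def)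
  have a0: "0 < a" using a by (smt (verit) of_nat_0_le_iff)
  have cont: "continuous_on UNIV u" using u by (rule C11_loc_continuous)
  have above: "\<exists>R. \<forall>x. R \<le> norm x \<longrightarrow> u x < l + \<epsilon>" if "0 < \<epsilon>" for \<epsilon>
  proof -
    have "Limsup at_infinity (\<lambda>x. ereal (u x)) < ereal (l + \<epsilon>)" using that by (simp add: lim)
    from Limsup_lessD[OF this] show ?thesis by (simp add: eventually_at_infinity)
  qed
  have below: "\<exists>x. R \<le> norm x \<and> l - \<epsilon> < u x" if "0 < \<epsilon>" for \<epsilon> R
  proof (rule ccontr)
    assume "\<not> ?thesis"
    then have "eventually (\<lambda>x. ereal (u x) \<le> ereal (l - \<epsilon>)) at_infinity"
      by (auto simp: eventually_at_infinity not_less)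
    from Limsup_bounded[OF this] show False using that by (simp add: lim)
  qed
  show "\<exists>M. \<forall>x. u x \<le> M"
  proof -
    obtain R where R: "\<And>x. R \<le> norm x \<Longrightarrow> u x < l + 1" using above[of 1] by auto
    have "bounded (u ` cball 0 R)"
      by (intro compact_imp_bounded compact_continuous_image continuous_on_subset[OF cont]) auto
    then obtain B where B: "\<And>x. norm x \<le> R \<Longrightarrow> \<bar>u x\<bar> \<le> B" 
      unfolding bounded_iff by (metis imageI mem_cball_0 real_norm_def)
    have "u x \<le> max B (l + 1)" for x
      using R[of x] B[of x] by (cases "norm x \<le> R") auto
    then show ?thesis by blast
  qed
  then obtain M where M: "\<And>x. u x \<le> M" by blast
  have bd: "\<bar>u x\<bar> \<le> M" for x using M[of x] u0[of x] by simp
  have "l \<le> 0"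
  proof (rule ccontr)
    assume "\<not> l \<le> 0"
    then have l0: "0 < l" by simp
    define c where "c = l - l powr p"
    have c: "0 < c" using powr_threshold_less_1[OF p l0 l] by (simp add: c_def)
    have "isCont (\<lambda>t. t - t powr p) l" using l0 by (intro continuous_intros) auto
    then obtain \<epsilon>\<^sub>0 where \<epsilon>0: "0 < \<epsilon>\<^sub>0" and near: "\<And>t. \<bar>t - l\<bar> < \<epsilon>\<^sub>0 \<Longrightarrow> \<bar>(t - t powr p) - c\<bar> < c / 2"
      using c unfolding continuous_at_eps_delta by (metis c_def dist_real_def half_gt_zero)
    let ?m = "\<lambda>z :: real ^ 'n. min 1 ((norm z)\<^sup>2) / norm z powr a"
    define J where "J = (LINT z|lborel. ?m z)"
    have J: "0 \<le> J" unfolding J_def by (intro Bochner_Integration.integral_nonneg) auto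
    have mi: "integrable lborel ?m" using a by (intro integrable_levy_kernel) auto
    define b where "b = \<Theta> powr a"
    have b: "0 < b" using \<theta> by (simp add: b_def)
    \<comment> \<open>\<open>Fs\<close> is to be at most \<open>c / 4\<close>. After the halving in
      \<open>levy_operator\<close> the bump costs 3 \<epsilon> b J, which 24 turns into at most
      \<open>c / 8\<close>; the tail takes the other \<open>c / 8\<close>. \<open>J + 1\<close>
      excludes division by 0.\<close>
    define \<epsilon> where "\<epsilon> = min \<epsilon>\<^sub>0 (c / (24 * b * (J + 1)))"
    have \<epsilon>: "0 < \<epsilon>" "\<epsilon> \<le> \<epsilon>\<^sub>0" using \<epsilon>0 c b J by (auto simp: \<epsilon>_def)
    have \<epsilon>J: "3 * \<epsilon> * b * J \<le> c / 8"
    proof -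
      have "\<epsilon> * (24 * b * (J + 1)) \<le> c" using b J c by (simp add: \<epsilon>_def min_le_iff_disj flip: pos_le_divide_eq)
      moreover have "\<epsilon> * b * J \<le> \<epsilon> * b * (J + 1)" using \<epsilon> b by (intro mult_left_mono) auto
      ultimately show ?thesis by simp
    qed
    let ?T = "\<lambda>n. LINT z|lborel. indicator (- ball 0 (real n)) z * ?m z"
    have "(\<lambda>n. M * b * ?T n) \<longlonglongrightarrow> M * b * 0"
      by (intro tendsto_intros levy_tail_tendsto_0) (use a in auto)
    then have "eventually (\<lambda>n. M * b * ?T n < c / 8) sequentially"
      using c by (intro order_tendstoD) auto
    then have "eventually (\<lambda>n. 1 \<le> n \<and> M * b * ?T n < c / 8) sequentially"
      using eventually_ge_at_top[of "1::nat"] by eventually_elim simp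
    then obtain n where n: "1 \<le> n" "M * b * ?T n < c / 8"
      using eventually_happens'[OF sequentially_bot] by fast
    obtain R where R: "\<And>y. R \<le> norm y \<Longrightarrow> u y < l + \<epsilon>" using above[OF \<epsilon>(1)] by auto
    obtain x\<^sub>0 where x0: "max R 0 + 1 + real n \<le> norm x\<^sub>0" "l - \<epsilon> < u x\<^sub>0" using below[OF \<epsilon>(1)] by blast
    obtain x where x: "dist x\<^sub>0 x \<le> 1" "l - \<epsilon> < u x" "u x < l + \<epsilon>"
      and sd: "\<And>z. R \<le> norm (x + z) \<Longrightarrow> R \<le> norm (x - z) \<Longrightarrow> u (x + z) + u (x - z) - 2 * u x \<le> 6 * \<epsilon> * min 1 ((norm z)\<^sup>2)"
      by (rule almost_maximum_second_difference[OF cont \<epsilon>(1) R _ x0(2)]) (use x0 in auto)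
    \<comment> \<open>The extra 1 in the choice of \<open>x\<^sub>0\<close> pays for passing to
      \<open>x\<close>; displacements shorter than \<open>n\<close> then keep both
      \<open>x + z\<close> and \<open>x - z\<close> outside radius \<open>R\<close>.\<close>
    have nx: "R + real n \<le> norm x" using x0(1) x(1) norm_triangle_ineq2[of x\<^sub>0 x] by (simp add: dist_norm)
    let ?D = "\<lambda>z. u (x + z) + u (x - z) - 2 * u x"
    have Dle: "?D z \<le> 6 * \<epsilon> * min 1 ((norm z)\<^sup>2) + 2 * M * (indicator (- ball 0 (real n)) z * min 1 ((norm z)\<^sup>2))" for z
    proof (cases "norm z < real n")
      case True
      then have "R \<le> norm (x + z)" "R \<le> norm (x - z)"
        using nx norm_triangle_ineq2[of x "- z"] norm_triangle_ineq2[of x z] by simp_all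
      from sd[OF this] True show ?thesis by simp
    next
      case False
      then have "1 \<le> norm z" using n by simp
      then have "1 \<le> (norm z)\<^sup>2" by simp
      moreover have "?D z \<le> 2 * M" using M[of "x + z"] M[of "x - z"] u0[of x] by linarith
      ultimately show ?thesis using False \<epsilon> by simp
    qed
    \<comment> \<open>One matrix suffices to bound an infimum from above, and a multiple of the
      identity has every unit vector as an eigenvector.\<close>
    have A: "mat \<theta> \<in> admissible \<theta> \<Theta> e" by (rule admissible_nonempty[OF \<theta> e])
    obtain C where C: "\<And>z. \<bar>?D z\<bar> \<le> C * min 1 ((norm z)\<^sup>2)"
      using C11_loc_second_difference[OF u bd] by metis
    have um: "u \<in> borel_measurable borel" by (rule borel_measurable_continuous_onI[OF cont])
    note um[measurable]
    have [measurable]: "- ball (0 :: real ^ 'n) t \<in> sets borel" for t by (intro borel_comp) simp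
    have int1: "integrable lborel (\<lambda>z. ?D z * levy_kernel (mat \<theta>) a z)"
      by (rule integrable_const_levy_kernel(1)[OF A \<theta> a _ C]) measurable
    have tail: "integrable lborel (\<lambda>z. indicator (- ball 0 (real n)) z * ?m z)"
      by (rule Bochner_Integration.integrable_bound[OF mi])
        (measurable, auto split: split_indicator)
    have int2: "integrable lborel (\<lambda>z. 6 * \<epsilon> * b * ?m z + 2 * M * b * (indicator (- ball 0 (real n)) z * ?m z))"
      by (intro Bochner_Integration.integrable_add integrable_mult_right mi tail)
    have pw: "?D z * levy_kernel (mat \<theta>) a z \<le> 6 * \<epsilon> * b * ?m z + 2 * M * b * (indicator (- ball 0 (real n)) z * ?m z)" for z
    proof -
      let ?E = "6 * \<epsilon> * min 1 ((norm z)\<^sup>2) + 2 * M * (indicator (- ball 0 (real n)) z * min 1 ((norm z)\<^sup>2))"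
      have "0 \<le> M" using u0[of 0] M[of 0] by linarith
      then have "0 \<le> ?E" using \<epsilon> by (intro add_nonneg_nonneg mult_nonneg_nonneg) auto
      then have "?D z * levy_kernel (mat \<theta>) a z \<le> ?E * (b / norm z powr a)"
        using Dle[of z] levy_kernel_le[OF A \<theta> a0, of z] by (intro mult_mono) (auto simp: b_def)
      then show ?thesis by (simp add: algebra_simps)
    qed
    have "levy_operator (mat \<theta>) a (\<lambda>z. u (x + z)) \<le> (6 * \<epsilon> * b * J + 2 * M * b * ?T n) / 2"
    proof -
      have "(LINT z|lborel. ?D z * levy_kernel (mat \<theta>) a z)
          \<le> (LINT z|lborel. 6 * \<epsilon> * b * ?m z + 2 * M * b * (indicator (- ball 0 (real n)) z * ?m z))"
        by (rule integral_mono[OF int1 int2 pw])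
      also have "\<dots> = 6 * \<epsilon> * b * J + 2 * M * b * ?T n"
        unfolding J_def
        by (subst Bochner_Integration.integral_add[OF integrable_mult_right[OF mi] integrable_mult_right[OF tail]])
          (simp only: integral_mult_right_zero)
      finally show ?thesis by (simp add: levy_operator_def)
    qed
    then have "Fs s \<theta> \<Theta> e u x \<le> c / 4"
      using Fs_extremal(1)[OF s \<theta> e u bd A, of x] n(2) \<epsilon>J by (simp add: a_def)
    moreover have "\<bar>(u x - u x powr p) - c\<bar> < c / 2" using x \<epsilon> by (intro near) auto
    moreover have "Fs s \<theta> \<Theta> e u x = u x - u x powr p" using eq[of x] by linarith
    ultimately show False using c by linarith
  qed
  show "(u \<longlongrightarrow> 0) at_infinity"
  proof (rule tendstoI)
    fix \<epsilon> :: real assume "0 < \<epsilon>"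
    then obtain R where "\<And>x. R \<le> norm x \<Longrightarrow> u x < l + \<epsilon>" using above by blast
    then have "\<And>x. R \<le> norm x \<Longrightarrow> dist (u x) 0 < \<epsilon>"
      using \<open>l \<le> 0\<close> u0 by (simp add: dist_norm) (meson add_le_same_cancel2 less_le_trans)
    then show "eventually (\<lambda>x. dist (u x) 0 < \<epsilon>) at_infinity" by (auto simp: eventually_at_infinity)
  qed
qed

section \<open>Moving planes\<close>

lemma powr_mean_value:
  fixes b c p :: real
  assumes "1 < p" "0 \<le> b" "b < c"
  obtains \<xi> where "b < \<xi>" "\<xi> < c" "c powr p - b powr p = (c - b) * (p * \<xi> powr (p - 1))"
proof -
  have "continuous_on {b..c} (\<lambda>t. t powr p)"
    using assms by (intro continuous_on_powr' continuous_intros) auto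
  \<comment> \<open>Differentiability is claimed only to the right of \<open>b\<close>, since
    \<open>b = 0\<close> is allowed.\<close>
  moreover have der: "((\<lambda>t. t powr p) has_real_derivative p * t powr (p - 1)) (at t)" if "b < t" for t
    using that assms by (auto intro!: derivative_eq_intros)
  then have "(\<lambda>t. t powr p) differentiable (at t)" if "b < t" for t
    using that by (auto simp: real_differentiable_def)
  ultimately obtain L \<xi> where "b < \<xi>" "\<xi> < c" "((\<lambda>t. t powr p) has_real_derivative L) (at \<xi>)"
    "c powr p - b powr p = (c - b) * L"
    using MVT[of b c "\<lambda>t. t powr p"] assms by blast
  then show ?thesis using der DERIV_unique that by blast
qed

text \<open>The threshold raised to the power \<open>p - 1\<close> is \<open>1 / p\<close>, so the
  slope of \<open>t powr p\<close> at the intermediate point is below 1.\<close>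

lemma reaction_strict_mono:
  fixes b c p :: real
  assumes "1 < p" "0 \<le> b" "b < c" "c \<le> (1 / p) powr (1 / (p - 1))"
  shows "b - b powr p < c - c powr p"
proof -
  obtain \<xi> where \<xi>: "b < \<xi>" "\<xi> < c" and eq: "c powr p - b powr p = (c - b) * (p * \<xi> powr (p - 1))"
    using powr_mean_value[OF assms(1-3)] by blast
  have "\<xi> powr (p - 1) < ((1 / p) powr (1 / (p - 1))) powr (p - 1)"
    using \<xi> assms by (intro powr_less_mono2) auto
  also have "\<dots> = 1 / p" using assms(1) by (simp add: powr_powr)
  finally have "p * \<xi> powr (p - 1) < 1" using assms(1) by (simp add: field_simps)
  then have "(c - b) * (p * \<xi> powr (p - 1)) < (c - b) * 1"
    using assms(3) by (intro mult_strict_left_mono) auto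
  then show ?thesis using eq by simp
qed

lemma powr_diff_le:
  fixes b c p M :: real
  assumes "1 < p" "0 \<le> b" "b < c" "c \<le> M"
  shows "c powr p - b powr p \<le> (c - b) * (p * M powr (p - 1))"
proof -
  obtain \<xi> where \<xi>: "b < \<xi>" "\<xi> < c" and eq: "c powr p - b powr p = (c - b) * (p * \<xi> powr (p - 1))"
    using powr_mean_value[OF assms(1-3)] by blast
  have "\<xi> powr (p - 1) \<le> M powr (p - 1)" using \<xi> assms by (intro powr_mono2) auto
  then show ?thesis unfolding eq using assms by (intro mult_left_mono) auto
qed

text \<open>The closest point is the foot of the perpendicular, by Cauchy-Schwarz. This ties the
  explicit formula used in calculations to the definition of symmetry.\<close>

lemma reflection_hyperplane:
  assumes e: "norm e = 1"
  shows "reflection {x. e \<bullet> x = c} x = mirror e c x"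
proof -
  let ?T = "{x. e \<bullet> x = c}" and ?y = "x + (c - x \<bullet> e) *\<^sub>R e"
  have ee: "e \<bullet> e = 1" using e by (simp add: dot_square_norm)
  have "?y = closest_point ?T x"
  proof (rule closest_point_unique)
    show "convex ?T" by (rule convex_hyperplane)
    show "closed ?T" by (rule closed_hyperplane)
    show "?y \<in> ?T" by (simp add: inner_add_right ee inner_commute)
    show "\<forall>z\<in>?T. dist x ?y \<le> dist x z"
    proof
      fix z assume "z \<in> ?T"
      then have "c - x \<bullet> e = (z - x) \<bullet> e" by (simp add: inner_diff_left inner_diff_right inner_commute)
      then have "\<bar>c - x \<bullet> e\<bar> \<le> norm (z - x)" using Cauchy_Schwarz_ineq2[of "z - x" e] e by simp
      then show "dist x ?y \<le> dist x z" using e by (simp add: dist_norm norm_minus_commute)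
    qed
  qed
  then show ?thesis
    unfolding reflection_def mirror_def by (simp only: scaleR_add_right scaleR_scaleR scaleR_2 flip: \<open>?y = closest_point ?T x\<close>) simp
qed

section \<open>Reflected differences of a decaying solution\<close>

locale decaying_solution =
  fixes u :: "real ^ 'n \<Rightarrow> real" and e :: "real ^ 'n" and s \<theta> \<Theta> p M :: real
  assumes s: "0 < s" "s < 1" and \<theta>: "0 < \<theta>" "\<theta> \<le> \<Theta>" and e: "norm e = 1" and p: "1 < p"
    and C11: "u \<in> C11_loc" and nonneg: "\<And>x. 0 \<le> u x" and bounded: "\<And>x. u x \<le> M"
    and vanish: "(u \<longlongrightarrow> 0) at_infinity"
    and equation: "\<And>x. - Fs s \<theta> \<Theta> e u x + u x = u x powr p"
begin

definition w :: "real \<Rightarrow> real ^ 'n \<Rightarrow> real" where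
  "w l x = u (mirror e l x) - u x"

text \<open>The value 0 is allowed, so that one comparison serves both negative minima and the
  strong maximum principle.\<close>

definition minimum_at :: "real \<Rightarrow> real ^ 'n \<Rightarrow> bool" where
  "minimum_at l x \<longleftrightarrow> x \<bullet> e < l \<and> w l x \<le> 0 \<and> (\<forall>y. y \<bullet> e \<le> l \<longrightarrow> w l x \<le> w l y)"

lemma abs_bounded: "\<bar>u x\<bar> \<le> M"
  using nonneg[of x] bounded[of x] by simp

lemma Fs_solution: "Fs s \<theta> \<Theta> e u x = u x - u x powr p"
  using equation[of x] by linarith

lemma continuous_u: "continuous_on A f \<Longrightarrow> continuous_on A (\<lambda>x. u (f x))"
  by (rule continuous_on_compose2[OF C11_loc_continuous[OF C11]]) auto

lemma continuous_w: "continuous_on A f \<Longrightarrow> continuous_on A g \<Longrightarrow> continuous_on A (\<lambda>x. w (f x) (g x))"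
  unfolding w_def mirror_def by (intro continuous_intros continuous_u)

lemma tendsto_w: "(f \<longlongrightarrow> l) F \<Longrightarrow> (g \<longlongrightarrow> x) F \<Longrightarrow> ((\<lambda>k. w (f k) (g k)) \<longlongrightarrow> w l x) F"
proof -
  assume f: "(f \<longlongrightarrow> l) F" and g: "(g \<longlongrightarrow> x) F"
  have "isCont (\<lambda>q. w (fst q) (snd q)) (l, x)"
    using continuous_w[of UNIV fst snd]
    by (simp add: continuous_on_fst continuous_on_snd continuous_on_id continuous_on_eq_continuous_at)
  from isCont_tendsto_compose[OF this tendsto_Pair[OF f g]] show ?thesis by simp
qed

lemma w_on_plane: "x \<bullet> e = l \<Longrightarrow> w l x = 0"
  by (simp add: w_def mirror_def)

text \<open>As \<open>u\<close> is nonnegative, \<open>w l x \<ge> - u x\<close>. Decay at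
  \<open>x\<close> alone thus keeps \<open>w l\<close> above a given negative value far out,
  wherever the mirror image lies.\<close>

lemma negative_minimum_exists:
  assumes y: "y \<bullet> e \<le> l" "w l y < 0"
  obtains x where "minimum_at l x" "w l x < 0"
proof -
  have "eventually (\<lambda>x. u x < - w l y) at_infinity"
    using order_tendstoD(2)[OF vanish, of "- w l y"] y(2) by simp
  then obtain R where R: "\<And>x. R \<le> norm x \<Longrightarrow> u x < - w l y" by (auto simp: eventually_at_infinity)
  define K where "K = cball 0 (max R (norm y)) \<inter> {x. x \<bullet> e \<le> l}"
  have "closed {x. x \<bullet> e \<le> l}" by (intro closed_Collect_le continuous_intros)
  then have "compact K" unfolding K_def by (intro compact_Int_closed) auto
  moreover have "y \<in> K" using y by (simp add: K_def)
  then have "K \<noteq> {}" by blast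
  moreover have "continuous_on K (w l)" by (intro continuous_w continuous_intros)
  ultimately have "\<exists>x\<in>K. \<forall>y\<in>K. w l x \<le> w l y" by (rule continuous_attains_inf)
  then obtain x where x: "x \<in> K" and mn: "\<And>y. y \<in> K \<Longrightarrow> w l x \<le> w l y" by blast
  have "w l x \<le> w l y" using y by (intro mn) (auto simp: K_def)
  moreover have "w l x \<le> w l y'" if y': "y' \<bullet> e \<le> l" for y'
  proof (cases "y' \<in> K")
    case False
    then have "R \<le> norm y'" using y' by (auto simp: K_def)
    then have "w l y < w l y'" using R[of y'] nonneg[of "mirror e l y'"] by (simp add: w_def)
    then show ?thesis using \<open>w l x \<le> w l y\<close> by simp
  qed (rule mn)
  moreover have "x \<bullet> e < l" using x w_on_plane[of x l] y(2) \<open>w l x \<le> w l y\<close>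
    by (cases "x \<bullet> e = l") (auto simp: K_def)
  ultimately show ?thesis using y(2) by (intro that[of x]) (auto simp: minimum_at_def)
qed

lemma comparison_at_minimum:
  assumes x: "minimum_at l x" and S: "\<And>z. z \<in> ball q r \<Longrightarrow> z \<bullet> e < l - x \<bullet> e \<and> \<rho> \<le> norm z" and \<rho>: "0 < \<rho>"
    and \<kappa>: "\<And>A z. A \<in> admissible \<theta> \<Theta> e \<Longrightarrow> z \<in> ball q r \<Longrightarrow>
      \<kappa> \<le> (w l (x + z) - w l x) * (levy_kernel A (real CARD('n) + 2 * s) z
            - levy_kernel A (real CARD('n) + 2 * s) (mirror e (l - x \<bullet> e) z))
        - 2 * w l x * levy_kernel A (real CARD('n) + 2 * s) (mirror e (l - x \<bullet> e) z)"
  shows "\<kappa> * measure lborel (ball q r)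
    \<le> (u (mirror e l x) - u (mirror e l x) powr p) - (u x - u x powr p)"
  unfolding Fs_solution[symmetric]
proof (rule Fs_comparison[OF s \<theta> e C11 abs_bounded _ refl _ _ S \<rho>])
  show "0 < l - x \<bullet> e" using x by (simp add: minimum_at_def)
  show "u (mirror e l x) - u x \<le> 0" using x by (simp add: minimum_at_def w_def)
  show "u (mirror e l x) - u x \<le> u (mirror e l y) - u y" if "y \<bullet> e \<le> l" for y
    using x that by (simp add: minimum_at_def w_def)
qed (use \<kappa> in \<open>simp_all add: w_def\<close>)

text \<open>The ball of radius \<open>\<delta>\<close> around \<open>-2\<delta>e\<close> is reflected to the ball around \<open>4\<delta>e\<close>, on which the
  kernel is of order \<open>\<delta>\<close> to the power \<open>- (n + 2s)\<close>.\<close>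

lemma negative_minimum_estimate:
  assumes x: "minimum_at l x" and \<delta>: "\<delta> = l - x \<bullet> e"
  shows "- 2 * w l x * (\<theta> / (5 * \<delta>)) powr (real CARD('n) + 2 * s) * (unit_ball_vol (real CARD('n)) * \<delta> ^ CARD('n))
    \<le> (u (mirror e l x) - u (mirror e l x) powr p) - (u x - u x powr p)"
proof -
  let ?a = "real CARD('n) + 2 * s"
  have a0: "0 < ?a" using s by (intro add_nonneg_pos) auto
  have \<delta>0: "0 < \<delta>" using x \<delta> by (simp add: minimum_at_def)
  have ee: "e \<bullet> e = 1" using e by (simp add: dot_square_norm)
  let ?q = "- (2 * \<delta>) *\<^sub>R e"
  have ze: "z \<bullet> e < - \<delta>" if "z \<in> ball ?q \<delta>" for z
  proof -
    have "(z - ?q) \<bullet> e \<le> norm (z - ?q) * norm e" by (rule norm_cauchy_schwarz)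
    also have "\<dots> < \<delta>" using that e by (simp add: dist_norm norm_minus_commute)
    finally show ?thesis by (simp add: inner_diff_left inner_add_left ee)
  qed
  have "- 2 * w l x * (\<theta> / (5 * \<delta>)) powr ?a * measure lborel (ball ?q \<delta>)
    \<le> (u (mirror e l x) - u (mirror e l x) powr p) - (u x - u x powr p)"
  proof (rule comparison_at_minimum[OF x])
    fix z assume z: "z \<in> ball ?q \<delta>"
    have "- (z \<bullet> e) \<le> norm z" using Cauchy_Schwarz_ineq2[of z e] e by simp
    then show "z \<bullet> e < l - x \<bullet> e \<and> \<delta> \<le> norm z" using ze[OF z] \<delta>0 \<delta> by linarith
  next
    fix A z assume A: "A \<in> admissible \<theta> \<Theta> e" and z: "z \<in> ball ?q \<delta>"
    have m4: "mirror e \<delta> ?q = (4 * \<delta>) *\<^sub>R e"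
      by (simp add: mirror_def ee flip: scaleR_add_left scaleR_diff_left)
    have "norm (mirror e \<delta> z) \<le> dist (mirror e \<delta> z) (mirror e \<delta> ?q) + norm (mirror e \<delta> ?q)"
      using norm_triangle_sub[of "mirror e \<delta> z" "mirror e \<delta> ?q"] by (simp add: dist_norm)
    also have "dist (mirror e \<delta> z) (mirror e \<delta> ?q) < \<delta>"
      using z by (simp add: dist_mirror e dist_commute)
    \<comment> \<open>The image of the centre has norm 4 \<delta>, and the reflected ball still has
      radius \<delta>.\<close>
    finally have n5: "norm (mirror e \<delta> z) \<le> 5 * \<delta>" unfolding m4 using e \<delta>0 by simp
    have z0: "z \<noteq> 0" using ze[OF z] \<delta>0 by auto
    have "mirror e \<delta> z \<bullet> e > 0" using ze[OF z] \<delta>0 e by simp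
    then have mz0: "mirror e \<delta> z \<noteq> 0" by auto
    have "(\<theta> / (5 * \<delta>)) powr ?a \<le> levy_kernel A ?a (mirror e \<delta> z)"
      by (rule levy_kernel_ge[OF A \<theta> a0 mz0 n5])
    then have "- 2 * w l x * (\<theta> / (5 * \<delta>)) powr ?a \<le> - 2 * w l x * levy_kernel A ?a (mirror e \<delta> z)"
      using x by (intro mult_left_mono) (auto simp: minimum_at_def)
    \<comment> \<open>Here this term only needs its sign; the estimate rests on the depth of the
      minimum. In the strong maximum principle the roles are exchanged.\<close>
    moreover have "0 \<le> (w l (x + z) - w l x) * (levy_kernel A ?a z - levy_kernel A ?a (mirror e \<delta> z))"
    proof (rule mult_nonneg_nonneg)
      have "(x + z) \<bullet> e \<le> l" using ze[OF z] \<delta>0 \<delta> by (simp add: inner_add_left)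
      then show "0 \<le> w l (x + z) - w l x" using x by (simp add: minimum_at_def)
      show "0 \<le> levy_kernel A ?a z - levy_kernel A ?a (mirror e \<delta> z)"
        using levy_kernel_mirror_le[OF A \<theta>(1) e a0 _ _ z0] ze[OF z] \<delta>0 by simp
    qed
    ultimately show "- 2 * w l x * (\<theta> / (5 * \<delta>)) powr ?a
        \<le> (w l (x + z) - w l x) * (levy_kernel A ?a z - levy_kernel A ?a (mirror e (l - x \<bullet> e) z))
          - 2 * w l x * levy_kernel A ?a (mirror e (l - x \<bullet> e) z)"
      unfolding \<delta>[symmetric] by linarith
  qed (rule \<delta>0)
  then show ?thesis using \<delta>0 by (simp add: content_ball)
qed

text \<open>One inequality is read twice: its sign confines \<open>x\<close>, and its size bounds
  the distance from the plane. Both constants are independent of \<open>l\<close>.\<close>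

lemma negative_minima_localized:
  obtains \<delta>\<^sub>0 R where "0 < \<delta>\<^sub>0" "\<And>l x. minimum_at l x \<Longrightarrow> w l x < 0 \<Longrightarrow> norm x \<le> R \<and> x \<bullet> e \<le> l - \<delta>\<^sub>0"
proof -
  define n where "n = real CARD('n)"
  let ?a = "n + 2 * s"
  define V where "V = unit_ball_vol n"
  have V: "0 < V" unfolding V_def n_def by (intro unit_ball_vol_pos) simp
  define t where "t = (1 / p) powr (1 / (p - 1))"
  have "0 < t" using p by (simp add: t_def)
  then have "eventually (\<lambda>x. u x < t) at_infinity" by (rule order_tendstoD[OF vanish])
  then obtain R where R: "\<And>x. R \<le> norm x \<Longrightarrow> u x < t" by (auto simp: eventually_at_infinity)
  \<comment> \<open>The summand 1 keeps \<open>C\<close>, and with it the distance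
    \<open>C powr (- 1 / (2 * s))\<close>, positive even when \<open>M\<close> is 0.\<close>
  define C where "C = p * M powr (p - 1) / (2 * (\<theta> / 5) powr ?a * V) + 1"
  have C: "0 < C" using p V \<theta> by (auto simp: C_def intro!: add_nonneg_pos divide_nonneg_nonneg)
  have "norm x \<le> R \<and> x \<bullet> e \<le> l - C powr (- 1 / (2 * s))" if x: "minimum_at l x" "w l x < 0" for l x
  proof
    define \<delta> where "\<delta> = l - x \<bullet> e"
    have \<delta>: "0 < \<delta>" using x by (simp add: \<delta>_def minimum_at_def)
    have k: "(\<theta> / (5 * \<delta>)) powr ?a * (V * \<delta> ^ CARD('n)) = (\<theta> / 5) powr ?a * V * \<delta> powr (- (2 * s))"
    proof -
      have "(\<theta> / (5 * \<delta>)) powr b = (\<theta> / 5) powr b * \<delta> powr (- b)" for b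
        using \<theta> \<delta> by (simp add: powr_divide powr_mult powr_minus field_simps)
      moreover have "\<delta> ^ CARD('n) = \<delta> powr n" using \<delta> by (simp add: n_def powr_realpow)
      moreover have "\<delta> powr (- ?a) * \<delta> powr n = \<delta> powr (- (2 * s))" by (simp flip: powr_add)
      ultimately show ?thesis by (simp add: mult_ac)
    qed
    have est: "- 2 * w l x * ((\<theta> / 5) powr ?a * V * \<delta> powr (- (2 * s)))
        \<le> (u (mirror e l x) - u (mirror e l x) powr p) - (u x - u x powr p)"
      using negative_minimum_estimate[OF x(1) \<delta>_def] unfolding n_def[symmetric] V_def[symmetric] k[symmetric]
      by (simp only: mult.assoc)
    have less: "u (mirror e l x) < u x" using x(2) by (simp add: w_def)
    have "0 < - 2 * w l x * ((\<theta> / 5) powr ?a * V * \<delta> powr (- (2 * s)))"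
    proof (rule mult_pos_pos)
      show "0 < (\<theta> / 5) powr ?a * V * \<delta> powr (- (2 * s))" using V \<theta> \<delta> by simp
    qed (use x(2) in simp)
    then have "\<not> u x \<le> t" using est reaction_strict_mono[OF p nonneg less] unfolding t_def by linarith
    then show "norm x \<le> R" using R[of x] by (cases "R \<le> norm x") auto
    \<comment> \<open>The linear parts of the reaction differ by \<open>w l x\<close>, which is
      negative and dropped. What remains is proportional to \<open>- w l x\<close>, so this factor
      cancels.\<close>
    have "- 2 * w l x * ((\<theta> / 5) powr ?a * V * \<delta> powr (- (2 * s))) \<le> - w l x * (p * M powr (p - 1))"
      using est powr_diff_le[OF p nonneg less bounded] less by (simp add: w_def)
    then have "2 * ((\<theta> / 5) powr ?a * V * \<delta> powr (- (2 * s))) \<le> p * M powr (p - 1)"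
      using mult_le_cancel_left_pos[of "- w l x" "2 * ((\<theta> / 5) powr ?a * V * \<delta> powr (- (2 * s)))"] x(2) by simp
    then have "\<delta> powr (- (2 * s)) \<le> p * M powr (p - 1) / (2 * (\<theta> / 5) powr ?a * V)"
      using V \<theta> by (simp add: pos_le_divide_eq mult_ac)
    then have "\<delta> powr (- (2 * s)) \<le> C" by (simp add: C_def)
    then have "C powr (- 1 / (2 * s)) \<le> (\<delta> powr (- (2 * s))) powr (- 1 / (2 * s))"
      using \<delta> s by (intro powr_mono2') (auto simp: divide_nonpos_pos)
    also have "\<dots> = \<delta>" using \<delta> s by (simp add: powr_powr)
    finally show "x \<bullet> e \<le> l - C powr (- 1 / (2 * s))" by (simp add: \<delta>_def)
  qed
  moreover have "0 < C powr (- 1 / (2 * s))" using C by simp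
  ultimately show ?thesis by (rule that[rotated])
qed

text \<open>At a zero minimum the reaction terms agree and the term with \<open>w l x\<close>
  vanishes. A positive value at \<open>y\<close> would then contribute a strictly positive amount
  through the uniform kernel gap.\<close>

lemma strong_maximum_principle:
  assumes pos: "\<And>y. y \<bullet> e \<le> l \<Longrightarrow> 0 \<le> w l y" and x: "x \<bullet> e < l" "w l x = 0" and y: "y \<bullet> e \<le> l"
  shows "w l y = 0"
proof (rule ccontr)
  assume "w l y \<noteq> 0"
  with pos[OF y] have wy: "0 < w l y" by simp
  let ?a = "real CARD('n) + 2 * s"
  have a0: "0 < ?a" using s by (intro add_nonneg_pos) auto
  have mn: "minimum_at l x" using x pos by (simp add: minimum_at_def)
  define \<delta> where "\<delta> = l - x \<bullet> e"
  have \<delta>: "0 < \<delta>" using x by (simp add: \<delta>_def)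
  define q where "q = y - x"
  have q0: "q \<noteq> 0" using wy x(2) by (auto simp: q_def)
  have "y \<bullet> e \<noteq> l" using wy w_on_plane[of y l] by auto
  then have qe: "q \<bullet> e < \<delta>" using y by (simp add: q_def \<delta>_def inner_diff_left)
  \<comment> \<open>Half the distance of \<open>y\<close> from the plane, so that a ball of radius
    at most \<open>d\<close> about \<open>q\<close> still leaves the distance \<open>d\<close> that
    the kernel gap asks for.\<close>
  define d where "d = (\<delta> - q \<bullet> e) / 2"
  then have \<delta>_eq: "\<delta> = q \<bullet> e + 2 * d" by (simp add: field_simps)
  then have d: "0 < d" using qe by simp
  have "isCont (\<lambda>z. w l (x + z)) q"
    using continuous_w[of UNIV "\<lambda>_. l" "\<lambda>z. x + z"]
    by (simp add: continuous_on_eq_continuous_at continuous_intros)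
  then obtain r\<^sub>0 where r0: "0 < r\<^sub>0" and near: "\<And>z. dist z q < r\<^sub>0 \<Longrightarrow> \<bar>w l (x + z) - w l y\<bar> < w l y / 2"
    using wy unfolding continuous_at_eps_delta q_def
    by (metis add_diff_cancel_left' diff_add_cancel dist_real_def half_gt_zero add.commute)
  \<comment> \<open>The three entries keep \<open>w l\<close> above half its value at
    \<open>y\<close>, the ball away from the singularity at the origin, and the ball away from the
    plane.\<close>
  define r where "r = min r\<^sub>0 (min (norm q / 2) d)"
  have r: "0 < r" "r \<le> r\<^sub>0" "r \<le> norm q / 2" "r \<le> d" using r0 q0 d by (auto simp: r_def)
  obtain \<kappa> where \<kappa>: "0 < \<kappa>"
    and gap: "\<And>A z. A \<in> admissible \<theta> \<Theta> e \<Longrightarrow> z \<noteq> 0 \<Longrightarrow> norm z \<le> 2 * norm q \<Longrightarrow> z \<bullet> e \<le> \<delta> - d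
      \<Longrightarrow> levy_kernel A ?a (mirror e \<delta> z) + \<kappa> \<le> levy_kernel A ?a z"
    using levy_kernel_gap[OF \<theta> e a0 \<delta> d, of "2 * norm q"] q0 by auto
  have ball: "z \<bullet> e \<le> \<delta> - d" "norm q / 2 \<le> norm z" "norm z \<le> 2 * norm q" "w l y / 2 \<le> w l (x + z)"
    if z: "z \<in> ball q r" for z
  proof -
    have dz: "norm (z - q) < r" using z by (simp add: dist_norm norm_minus_commute)
    have "z \<bullet> e - q \<bullet> e \<le> norm (z - q)"
      using norm_cauchy_schwarz[of "z - q" e] e by (simp add: inner_diff_left)
    then show "z \<bullet> e \<le> \<delta> - d" using dz r(4) \<delta>_eq by linarith
    show "norm q / 2 \<le> norm z" using dz r norm_triangle_ineq2[of q z] by (simp add: norm_minus_commute)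
    show "norm z \<le> 2 * norm q" using dz r norm_triangle_ineq2[of z q] by simp
    have "\<bar>w l (x + z) - w l y\<bar> < w l y / 2" using dz r by (intro near) (simp add: dist_norm)
    then show "w l y / 2 \<le> w l (x + z)" by linarith
  qed
  have "w l y / 2 * \<kappa> * measure lborel (ball q r)
    \<le> (u (mirror e l x) - u (mirror e l x) powr p) - (u x - u x powr p)"
  proof (rule comparison_at_minimum[OF mn, where \<rho> = "norm q / 2"])
    show "z \<bullet> e < l - x \<bullet> e \<and> norm q / 2 \<le> norm z" if "z \<in> ball q r" for z
      using ball[OF that] d by (simp add: \<delta>_def)
    show "0 < norm q / 2" using q0 by simp
    fix A z assume A: "A \<in> admissible \<theta> \<Theta> e" and z: "z \<in> ball q r"
    have "z \<noteq> 0" using ball(2)[OF z] q0 by auto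
    then have "w l y / 2 * \<kappa> \<le> w l (x + z) * (levy_kernel A ?a z - levy_kernel A ?a (mirror e \<delta> z))"
      using gap[OF A _ ball(3)[OF z] ball(1)[OF z]] ball(4)[OF z] wy \<kappa> by (intro mult_mono) auto
    then show "w l y / 2 * \<kappa> \<le> (w l (x + z) - w l x) * (levy_kernel A ?a z - levy_kernel A ?a (mirror e (l - x \<bullet> e) z))
        - 2 * w l x * levy_kernel A ?a (mirror e (l - x \<bullet> e) z)"
      by (simp add: x(2) \<delta>_def)
  qed
  moreover have "u (mirror e l x) = u x" using x(2) by (simp add: w_def)
  moreover have "0 < w l y / 2 * \<kappa> * measure lborel (ball q r)"
    using wy \<kappa> r by (intro mult_pos_pos) (auto simp: content_ball_gt_0_iff)
  ultimately show False by simp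
qed

text \<open>The failing plane bounds the admissible positions. If \<open>w c\<close> did not vanish,
  planes just beyond \<open>c\<close> would have negative minima accumulating at a point whose
  distance from the plane at \<open>c\<close> is at least \<open>\<delta>\<^sub>0\<close>, where
  \<open>w c\<close> is strictly positive.\<close>

lemma critical_plane:
  assumes "\<exists>l y. y \<bullet> e \<le> l \<and> w l y < 0"
  obtains c where "\<And>l y. l \<le> c \<Longrightarrow> y \<bullet> e \<le> l \<Longrightarrow> 0 \<le> w l y" "\<And>y. y \<bullet> e \<le> c \<Longrightarrow> w c y = 0"
proof -
  obtain \<delta>\<^sub>0 R where \<delta>0: "0 < \<delta>\<^sub>0" and loc: "\<And>l x. minimum_at l x \<Longrightarrow> w l x < 0 \<Longrightarrow> norm x \<le> R \<and> x \<bullet> e \<le> l - \<delta>\<^sub>0"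
    using negative_minima_localized by blast
  have neg: "\<exists>x. norm x \<le> R \<and> x \<bullet> e \<le> l - \<delta>\<^sub>0 \<and> w l x < 0" if "y \<bullet> e \<le> l" "w l y < 0" for l y
    using negative_minimum_exists[OF that] loc by metis
  define P where "P l \<longleftrightarrow> (\<forall>y. y \<bullet> e \<le> l \<longrightarrow> 0 \<le> w l y)" for l
  \<comment> \<open>All earlier planes are included, because monotonicity in the conclusion compares
    points across every plane up to \<open>c\<close>.\<close>
  define \<Lambda> where "\<Lambda> = {l. \<forall>l'\<le>l. P l'}"
  \<comment> \<open>A negative minimum for such a plane would lie strictly below \<open>- R\<close>
    in the direction \<open>e\<close>, hence outside the ball of radius \<open>R\<close>.\<close>
  have start: "- R \<in> \<Lambda>"
    unfolding \<Lambda>_def P_def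
  proof (intro CollectI allI impI)
    fix l y assume l: "l \<le> - R" and y: "y \<bullet> e \<le> l"
    show "0 \<le> w l y"
    proof (rule ccontr)
      assume "\<not> 0 \<le> w l y"
      then obtain x where "norm x \<le> R" "x \<bullet> e \<le> l - \<delta>\<^sub>0" using neg[OF y] by auto
      moreover have "- (x \<bullet> e) \<le> norm x" using Cauchy_Schwarz_ineq2[of x e] e by simp
      ultimately show False using l \<delta>0 by linarith
    qed
  qed
  obtain l\<^sub>1 where l1: "\<not> P l\<^sub>1" using assms by (force simp: P_def)
  have up: "l \<le> l\<^sub>1" if "l \<in> \<Lambda>" for l
  proof (rule ccontr)
    assume "\<not> l \<le> l\<^sub>1"
    then have "l\<^sub>1 \<le> l" by simp
    then show False using that l1 by (simp add: \<Lambda>_def)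
  qed
  then have bdd: "bdd_above \<Lambda>" by (rule bdd_aboveI)
  define c where "c = Sup \<Lambda>"
  have below: "P l" if lc: "l < c" for l
  proof -
    have "\<Lambda> \<noteq> {}" using start by auto
    then obtain l' where "l' \<in> \<Lambda>" "l < l'" using lc less_cSup_iff[of \<Lambda> l] bdd unfolding c_def by blast
    then show ?thesis by (simp add: \<Lambda>_def)
  qed
  have Pc: "P c"
    unfolding P_def
  proof (intro allI impI)
    fix y assume "y \<bullet> e \<le> c"
    show "0 \<le> w c y"
    proof (cases "y \<bullet> e = c")
      case False
      then have yc: "y \<bullet> e < c" using \<open>y \<bullet> e \<le> c\<close> by simp
      \<comment> \<open>With \<open>y\<close> fixed strictly inside, it also belongs to the half
        spaces of planes slightly before \<open>c\<close>, and nonnegativity passes to the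
        limit.\<close>
      have "((\<lambda>l. w l y) \<longlongrightarrow> w c y) (at_left c)" by (intro tendsto_w tendsto_intros)
      moreover have "eventually (\<lambda>l. 0 \<le> w l y) (at_left c)"
        using eventually_at_left_real[OF yc] by eventually_elim (use below in \<open>auto simp: P_def\<close>)
      ultimately show ?thesis by (intro tendsto_lowerbound) auto
    qed (simp add: w_on_plane)
  qed
  have upto: "P l" if "l \<le> c" for l using that below Pc by (cases "l = c") auto
  have zero: "w c y = 0" if y: "y \<bullet> e \<le> c" for y
  proof (rule ccontr)
    assume nz: "w c y \<noteq> 0"
    have strict: "0 < w c x" if "x \<bullet> e < c" for x
    proof -
      have "w c x \<noteq> 0" using strong_maximum_principle[OF _ that _ y] Pc nz by (auto simp: P_def)
      moreover have "0 \<le> w c x" using Pc that by (simp add: P_def)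
      ultimately show ?thesis by simp
    qed
    have "\<exists>l x. l \<le> c + 1 / real (Suc k) \<and> c < l \<and> norm x \<le> R \<and> x \<bullet> e \<le> l - \<delta>\<^sub>0 \<and> w l x < 0" for k
    proof -
      have "c + 1 / real (Suc k) \<notin> \<Lambda>"
      proof
        assume "c + 1 / real (Suc k) \<in> \<Lambda>"
        then have "c + 1 / real (Suc k) \<le> c" unfolding c_def using bdd by (rule cSup_upper)
        then show False by simp
      qed
      then obtain l where l: "l \<le> c + 1 / real (Suc k)" "\<not> P l" by (auto simp: \<Lambda>_def)
      \<comment> \<open>Failure of membership only yields some failing plane up to
        \<open>c + 1 / real (Suc k)\<close>; as all planes up to \<open>c\<close> are good, it lies
        beyond \<open>c\<close>.\<close>
      then have "c < l" using upto[of l] by (cases "l \<le> c") auto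
      with l neg[of _ l] show ?thesis by (auto simp: P_def not_le)
    qed
    then obtain f X where f: "\<And>k. f k \<le> c + 1 / real (Suc k)" "\<And>k. c < f k"
      and X: "\<And>k. norm (X k) \<le> R" "\<And>k. X k \<bullet> e \<le> f k - \<delta>\<^sub>0" "\<And>k. w (f k) (X k) < 0"
      by metis
    have "(\<lambda>k. c + 1 / real (Suc k)) \<longlonglongrightarrow> c + 0"
      by (intro tendsto_add tendsto_const LIMSEQ_Suc lim_1_over_n)
    then have "(\<lambda>k. c + 1 / real (Suc k)) \<longlonglongrightarrow> c" by simp
    then have flim: "f \<longlonglongrightarrow> c"
      by (rule tendsto_sandwich[rotated 2, OF tendsto_const]) (use f in \<open>auto intro!: always_eventually less_imp_le\<close>)
    have "compact (cball (0 :: real ^ 'n) R)" by simp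
    then obtain x h where h: "strict_mono (h :: nat \<Rightarrow> nat)" and Xlim: "(X \<circ> h) \<longlonglongrightarrow> x"
      using X(1) unfolding compact_def by (metis mem_cball_0)
    have fh: "(f \<circ> h) \<longlonglongrightarrow> c" using flim h by (rule LIMSEQ_subseq_LIMSEQ)
    have "(\<lambda>k. (X \<circ> h) k \<bullet> e) \<longlonglongrightarrow> x \<bullet> e" by (intro tendsto_intros Xlim)
    moreover have "(\<lambda>k. (f \<circ> h) k - \<delta>\<^sub>0) \<longlonglongrightarrow> c - \<delta>\<^sub>0" by (intro tendsto_intros fh)
    ultimately have "x \<bullet> e \<le> c - \<delta>\<^sub>0" by (rule LIMSEQ_le) (use X(2) in auto)
    then have "0 < w c x" using \<delta>0 by (intro strict) simp
    moreover have "(\<lambda>k. w ((f \<circ> h) k) ((X \<circ> h) k)) \<longlonglongrightarrow> w c x" by (rule tendsto_w[OF fh Xlim])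
    then have "w c x \<le> 0" by (rule LIMSEQ_le_const2) (use X(3) in \<open>auto intro: less_imp_le\<close>)
    ultimately show False by simp
  qed
  show ?thesis using upto zero by (intro that) (auto simp: P_def)
qed

lemma solution_eq_0:
  assumes pos: "\<And>l y. y \<bullet> e \<le> l \<Longrightarrow> 0 \<le> w l y"
  shows "u x = 0"
proof -
  have "u x \<le> u (x + real k *\<^sub>R e)" for k
  proof -
    \<comment> \<open>The plane halfway between the two points; it is available for every
      \<open>k\<close> because no plane fails.\<close>
    have "mirror e (x \<bullet> e + real k / 2) x = x + real k *\<^sub>R e" by (simp add: mirror_def)
    then show ?thesis using pos[of x "x \<bullet> e + real k / 2"] by (simp add: w_def)
  qed
  moreover have "filterlim (\<lambda>k. x + real k *\<^sub>R e) at_infinity sequentially"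
  proof (rule tendsto_add_filterlim_at_infinity[OF tendsto_const])
    show "filterlim (\<lambda>k. real k *\<^sub>R e) at_infinity sequentially"
      by (rule filterlim_norm_at_top_imp_at_infinity) (simp add: e filterlim_real_sequentially)
  qed
  then have "(\<lambda>k. u (x + real k *\<^sub>R e)) \<longlonglongrightarrow> 0" by (rule filterlim_compose[OF vanish])
  ultimately have "u x \<le> 0" by (intro LIMSEQ_le_const) auto
  then show ?thesis using nonneg[of x] by simp
qed

lemma symmetric_decreasing_solution: "\<exists>T. perp_hyperplane e T \<and> symmetric_decreasing e T u"
proof (cases "\<exists>l y. y \<bullet> e \<le> l \<and> w l y < 0")
  case True
  obtain c where pos: "\<And>l y. l \<le> c \<Longrightarrow> y \<bullet> e \<le> l \<Longrightarrow> 0 \<le> w l y" and zero: "\<And>y. y \<bullet> e \<le> c \<Longrightarrow> w c y = 0"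
    using critical_plane[OF True] by blast
  let ?T = "{x. e \<bullet> x = c}"
  have ee: "e \<bullet> e = 1" using e by (simp add: dot_square_norm)
  have sym: "u (mirror e c x) = u x" for x
  proof (cases "x \<bullet> e \<le> c")
    case False
    then show ?thesis using zero[of "mirror e c x"] e by (simp add: w_def)
  qed (use zero[of x] in \<open>simp add: w_def\<close>)
  have minus: "u (x - t2 *\<^sub>R e) \<le> u (x - t1 *\<^sub>R e)" if "x \<in> ?T" "0 \<le> t1" "t1 \<le> t2" for x t1 t2
  proof -
    \<comment> \<open>The plane midway between the two points to be compared. It does not lie beyond
      \<open>c\<close>, so the sign of \<open>w ?l\<close> is known.\<close>
    let ?l = "c - (t1 + t2) / 2"
    have xe: "(x - t2 *\<^sub>R e) \<bullet> e = c - t2" using that(1) by (simp add: inner_diff_left inner_diff_right ee inner_commute)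
    have "mirror e ?l (x - t2 *\<^sub>R e) = x - t1 *\<^sub>R e"
      unfolding mirror_def xe by (simp add: algebra_simps flip: scaleR_add_left)
    then show ?thesis using pos[of ?l "x - t2 *\<^sub>R e"] that xe by (simp add: w_def)
  qed
  have plus: "u (x + t *\<^sub>R e) = u (x - t *\<^sub>R e)" if "x \<in> ?T" for x t
  proof -
    have xe: "(x - t *\<^sub>R e) \<bullet> e = c - t" using that(1) by (simp add: inner_diff_left inner_diff_right ee inner_commute)
    have "mirror e c (x - t *\<^sub>R e) = x + t *\<^sub>R e"
      unfolding mirror_def xe by (simp add: algebra_simps flip: scaleR_add_left)
    then show ?thesis using sym[of "x - t *\<^sub>R e"] by simp
  qed
  have "symmetric_decreasing e ?T u"
    unfolding symmetric_decreasing_def reflection_hyperplane[OF e]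
    using sym minus plus by (auto simp: monotone_on_def)
  moreover have "perp_hyperplane e ?T" by (auto simp: perp_hyperplane_def)
  ultimately show ?thesis by blast
next
  case False
  then have "u x = 0" for x by (intro solution_eq_0) (force simp: not_less)
  \<comment> \<open>For the zero solution any perpendicular hyperplane will do.\<close>
  then have "symmetric_decreasing e {x. e \<bullet> x = 0} u"
    by (simp add: symmetric_decreasing_def monotone_on_def)
  moreover have "perp_hyperplane e {x. e \<bullet> x = 0}" by (auto simp: perp_hyperplane_def)
  ultimately show ?thesis by blast
qed

end

theorem theorem3p14:
  fixes u :: "real ^ 'n \<Rightarrow> real" and e :: "real ^ 'n" and s \<theta> \<Theta> p l :: real
  assumes "CARD('n) \<ge> 2"
    and "0 < s" and "s < 1"
    and "0 < \<theta>" and "\<theta> \<le> \<Theta>"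
    and "norm e = 1"
    and "1 < p"
    and "u \<in> \<L>s s" and "u \<in> C11_loc"
    and "\<forall>x. 0 \<le> u x"
    and "\<forall>x. - Fs s \<theta> \<Theta> e u x + u x = u x powr p"
    and "Limsup at_infinity (\<lambda>x. ereal (u x)) = ereal l"
    and "l < (1 / p) powr (1 / (p - 1))"
  shows "\<exists>T. perp_hyperplane e T \<and> symmetric_decreasing e T u"
proof -
  have sol: "\<And>x. 0 \<le> u x" "\<And>x. - Fs s \<theta> \<Theta> e u x + u x = u x powr p"
    using assms by blast+
  note vanish = solution_vanishes_at_infinity[OF assms(2-7,9) sol assms(12,13)]
  obtain M where "\<And>x. u x \<le> M" using vanish(1) by blast
  then interpret decaying_solution u e s \<theta> \<Theta> p M
    using assms vanish(2) by unfold_locales auto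
  show ?thesis by (rule symmetric_decreasing_solution)
qed

end
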